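(* Let $1\le n<\infty$. Every cell system on $\mathcal{A}^{(4n+2)\ast}$ is, up to equivalence, one of the two inequivalent cell systems $W^+$, $W^-$ given by $$W^{\pm}_{i,i,i+1}=\frac{\sqrt{[2i][2i+2]}}{[2]\sqrt{[2i+1]}}\sqrt{[2i]\mp[1]},\quad i=1,\ldots,2n-1,$$ $$W^{\pm}_{i,i+1,i+1}=\frac{\sqrt{[2i][2i+2]}}{[2]\sqrt{[2i+1]}}\sqrt{[2i+2]\pm[1]},\quad i=1,\ldots,2n-1,$$ $$W^{\pm}_{i,i,i}=\begin{cases}(-1)^{i+1}\dfrac{\sqrt{[2i]}}{[2]\sqrt{[2i-1][2i+1]}}\sqrt{[2][2i]\pm[4i]}, & i=1,\ldots,n,\\[2mm](-1)^{i+1}\dfrac{\sqrt{[2i]}}{[2]\sqrt{[2i-1][2i+1]}}\sqrt{[2][2i]\mp[8n+4-4i]}, & i=n+1,\ldots,2n.\end{cases}$$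
   Context: Let $q=e^{\pi i/(4n+2)}$ and $[m]=(q^m-q^{-m})/(q-q^{-1})$. The graph $\mathcal{A}^{(4n+2)\ast}$ has vertices $1,\ldots,2n$, one edge $i\to i+1$ and one edge $i+1\to i$ for $1\le i\le 2n-1$, and one loop $i\to i$ at every vertex $i$. Its Perron-Frobenius eigenvector (eigenvalue $[3]$) is $\phi_i=[2i]/[2]$. $W_{a,b,c}$ denotes the value of $W$ on the triangle $a\to b\to c\to a$. Cell systems: let $\mathcal{G}$ be a directed graph (loops and multiple edges allowed), with source and range maps $s,r$, Perron-Frobenius eigenvalue $[3]$ and positive Perron-Frobenius eigenvector $(\phi_i)$. A triangle $\triangle_{ijk}^{(\alpha\beta\gamma)}$ is a closed path $i\xrightarrow{\alpha}j\xrightarrow{\beta}k\xrightarrow{\gamma}i$, considered up to cyclic rotation. A cell system $W$ assigns to each triangle a complex number $W(\triangle_{ijk}^{(\alpha\beta\gamma)})$ such that: (I) for all edges $\alpha,\alpha'$ from $i$ to $j$, $\sum_{k,\beta,\gamma}W(\triangle_{ijk}^{(\alpha\beta\gamma)})\overline{W(\triangle_{ijk}^{(\alpha'\beta\gamma)})}=\delta_{\alpha,\alpha'}[2]\phi_i\phi_j$, the sum being over vertices $k$ and edges $\beta:j\to k$, $\gamma:k\to i$; (II) for all edges $\alpha_1,\dots,\alpha_4$ with $s(\alpha_1)=s(\alpha_4)=i_1$, $r(\alpha_1)=r(\alpha_2)=i_2$, $s(\alpha_2)=s(\alpha_3)=i_3$, $r(\alpha_3)=r(\alpha_4)=i_4$,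 $$\sum\phi_k^{-1}W(\triangle_{i_1i_2k}^{(\alpha_1\beta_1\beta_2)})\overline{W(\triangle_{i_3i_2k}^{(\alpha_2\beta_1\beta_3)})}W(\triangle_{i_3i_4k}^{(\alpha_3\beta_4\beta_3)})\overline{W(\triangle_{i_1i_4k}^{(\alpha_4\beta_4\beta_2)})}=\delta_{\alpha_1,\alpha_4}\delta_{\alpha_2,\alpha_3}\phi_{i_1}\phi_{i_2}\phi_{i_3}+\delta_{\alpha_1,\alpha_2}\delta_{\alpha_3,\alpha_4}\phi_{i_1}\phi_{i_2}\phi_{i_4},$$ the sum being over vertices $k$ and edges $\beta_1:i_2\to k$, $\beta_2:k\to i_1$, $\beta_3:k\to i_3$, $\beta_4:i_4\to k$. Two cell systems $W_1,W_2$ on $\mathcal{G}$ are equivalent if for each pair of adjacent vertices $i,j$ there is a unitary matrix $(u(\sigma,\sigma'))$ indexed by the edges from $i$ to $j$ such that for every triangle $W_1(\triangle_{ijk}^{(\sigma\rho\gamma)})=\sum_{\sigma',\rho',\gamma'}u(\sigma,\sigma')u(\rho,\rho')u(\gamma,\gamma')W_2(\triangle_{ijk}^{(\sigma'\rho'\gamma')})$, summing over edges $\sigma':i\to j$, $\rho':j\to k$, $\gamma':k\to i$. *)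

theory Defs
  imports "HOL-Analysis.Analysis" "Graph_Theory.Digraph"
begin

section \<open>Quantum integers\<close>

definition qint_complex :: "complex \<Rightarrow> int \<Rightarrow> complex" where
  "qint_complex q m = (q powi m - q powi (- m)) / (q - q powi (- 1))"

text \<open>
  For \<open>q\<close> on the unit circle the quotient is real (lemma \<open>of_real_qint\<close>), so taking the real part
  loses nothing and makes the order and the real square root available.
\<close>

definition qint :: "complex \<Rightarrow> int \<Rightarrow> real" where
  "qint q m = Re (qint_complex q m)"

lemma of_real_qint:
  assumes "norm q = 1"
  shows "complex_of_real (qint q m) = qint_complex q m"
proof -
  have q0: "q \<noteq> 0" using assms by auto
  have "q * cnj q = 1" using assms by (simp add: complex_norm_square[symmetric])
  then have c: "cnj q = inverse q" using q0 by (simp add: field_simps)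
  have cp: "cnj (q powi k) = q powi (- k)" for k
    by (simp add: c power_int_def power_inverse)
  have "cnj (qint_complex q m) = qint_complex q m"
    unfolding qint_complex_def complex_cnj_divide complex_cnj_diff cp c
    using q0 by (simp add: divide_simps) (simp add: algebra_simps)
  then show ?thesis
    unfolding qint_def by (metis Reals_cnj_iff of_real_Re)
qed

section \<open>Cell systems\<close>

definition arcs_from_to :: "('v, 'e) pre_digraph \<Rightarrow> 'v \<Rightarrow> 'v \<Rightarrow> 'e set" where
  "arcs_from_to G i j = {e \<in> arcs G. tail G e = i \<and> head G e = j}"

definition triangle :: "('v, 'e) pre_digraph \<Rightarrow> 'e \<Rightarrow> 'e \<Rightarrow> 'e \<Rightarrow> bool" where
  "triangle G \<alpha> \<beta> \<gamma> \<longleftrightarrow> \<alpha> \<in> arcs G \<and> \<beta> \<in> arcs G \<and> \<gamma> \<in> arcs G \<and>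
     head G \<alpha> = tail G \<beta> \<and> head G \<beta> = tail G \<gamma> \<and> head G \<gamma> = tail G \<alpha>"

definition adjacency_eigenvector ::
    "('v, 'e) pre_digraph \<Rightarrow> 'a::real_normed_field \<Rightarrow> ('v \<Rightarrow> 'a) \<Rightarrow> bool" where
  "adjacency_eigenvector G l x \<longleftrightarrow>
     (\<exists>i\<in>verts G. x i \<noteq> 0) \<and>
     (\<forall>i\<in>verts G. (\<Sum>e\<in>out_arcs G i. x (head G e)) = l * x i)"

definition perron_frobenius :: "('v, 'e) pre_digraph \<Rightarrow> real \<Rightarrow> ('v \<Rightarrow> real) \<Rightarrow> bool" where
  "perron_frobenius G l \<phi> \<longleftrightarrow>
     adjacency_eigenvector G l \<phi> \<and> (\<forall>i\<in>verts G. \<phi> i > 0) \<and>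
     (\<forall>(\<mu>::complex) x. adjacency_eigenvector G \<mu> x \<longrightarrow> norm \<mu> \<le> l)"

text \<open>
  A function on triangles up to cyclic rotation is represented by a function of the three edges that
  is invariant under rotation; its values on triples that are not triangles play no role.
\<close>

definition rotation_invariant ::
    "('v, 'e) pre_digraph \<Rightarrow> ('e \<Rightarrow> 'e \<Rightarrow> 'e \<Rightarrow> complex) \<Rightarrow> bool" where
  "rotation_invariant G W \<longleftrightarrow> (\<forall>\<alpha> \<beta> \<gamma>. triangle G \<alpha> \<beta> \<gamma> \<longrightarrow> W \<alpha> \<beta> \<gamma> = W \<beta> \<gamma> \<alpha>)"

definition cell_condition_I ::
    "('v, 'e) pre_digraph \<Rightarrow> complex \<Rightarrow> ('v \<Rightarrow> real) \<Rightarrow> ('e \<Rightarrow> 'e \<Rightarrow> 'e \<Rightarrow> complex) \<Rightarrow> bool" where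
  "cell_condition_I G q \<phi> W \<longleftrightarrow>
     (\<forall>i\<in>verts G. \<forall>j\<in>verts G. \<forall>\<alpha>\<in>arcs_from_to G i j. \<forall>\<alpha>'\<in>arcs_from_to G i j.
        (\<Sum>k\<in>verts G. \<Sum>\<beta>\<in>arcs_from_to G j k. \<Sum>\<gamma>\<in>arcs_from_to G k i.
            W \<alpha> \<beta> \<gamma> * cnj (W \<alpha>' \<beta> \<gamma>))
        = (if \<alpha> = \<alpha>' then complex_of_real (qint q 2 * \<phi> i * \<phi> j) else 0))"

definition cell_condition_II ::
    "('v, 'e) pre_digraph \<Rightarrow> ('v \<Rightarrow> real) \<Rightarrow> ('e \<Rightarrow> 'e \<Rightarrow> 'e \<Rightarrow> complex) \<Rightarrow> bool" where
  "cell_condition_II G \<phi> W \<longleftrightarrow>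
     (\<forall>i1\<in>verts G. \<forall>i2\<in>verts G. \<forall>i3\<in>verts G. \<forall>i4\<in>verts G.
      \<forall>\<alpha>1\<in>arcs_from_to G i1 i2. \<forall>\<alpha>2\<in>arcs_from_to G i3 i2.
      \<forall>\<alpha>3\<in>arcs_from_to G i3 i4. \<forall>\<alpha>4\<in>arcs_from_to G i1 i4.
        (\<Sum>k\<in>verts G. \<Sum>\<beta>1\<in>arcs_from_to G i2 k. \<Sum>\<beta>2\<in>arcs_from_to G k i1.
         \<Sum>\<beta>3\<in>arcs_from_to G k i3. \<Sum>\<beta>4\<in>arcs_from_to G i4 k.
            complex_of_real (inverse (\<phi> k)) *
            W \<alpha>1 \<beta>1 \<beta>2 * cnj (W \<alpha>2 \<beta>1 \<beta>3) * W \<alpha>3 \<beta>4 \<beta>3 * cnj (W \<alpha>4 \<beta>4 \<beta>2))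
        = (if \<alpha>1 = \<alpha>4 \<and> \<alpha>2 = \<alpha>3 then complex_of_real (\<phi> i1 * \<phi> i2 * \<phi> i3) else 0)
        + (if \<alpha>1 = \<alpha>2 \<and> \<alpha>3 = \<alpha>4 then complex_of_real (\<phi> i1 * \<phi> i2 * \<phi> i4) else 0))"

definition cell_system ::
    "('v, 'e) pre_digraph \<Rightarrow> complex \<Rightarrow> ('v \<Rightarrow> real) \<Rightarrow> ('e \<Rightarrow> 'e \<Rightarrow> 'e \<Rightarrow> complex) \<Rightarrow> bool" where
  "cell_system G q \<phi> W \<longleftrightarrow>
     fin_digraph G \<and> perron_frobenius G (qint q 3) \<phi> \<and>
     rotation_invariant G W \<and> cell_condition_I G q \<phi> W \<and> cell_condition_II G \<phi> W"

definition unitary_on :: "'e set \<Rightarrow> ('e \<Rightarrow> 'e \<Rightarrow> complex) \<Rightarrow> bool" where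
  "unitary_on E u \<longleftrightarrow>
     (\<forall>\<sigma>\<in>E. \<forall>\<tau>\<in>E. (\<Sum>\<rho>\<in>E. u \<sigma> \<rho> * cnj (u \<tau> \<rho>)) = (if \<sigma> = \<tau> then 1 else 0)) \<and>
     (\<forall>\<sigma>\<in>E. \<forall>\<tau>\<in>E. (\<Sum>\<rho>\<in>E. cnj (u \<rho> \<sigma>) * u \<rho> \<tau>) = (if \<sigma> = \<tau> then 1 else 0))"

text \<open>
  Edge sets for different ordered pairs of vertices are disjoint, so one function \<open>u\<close> on pairs of
  edges carries all the unitary matrices at once.
\<close>

definition cell_equivalent ::
    "('v, 'e) pre_digraph \<Rightarrow> ('e \<Rightarrow> 'e \<Rightarrow> 'e \<Rightarrow> complex) \<Rightarrow> ('e \<Rightarrow> 'e \<Rightarrow> 'e \<Rightarrow> complex) \<Rightarrow> bool" where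
  "cell_equivalent G W1 W2 \<longleftrightarrow>
     (\<exists>u. (\<forall>i\<in>verts G. \<forall>j\<in>verts G. unitary_on (arcs_from_to G i j) u) \<and>
        (\<forall>i\<in>verts G. \<forall>j\<in>verts G. \<forall>k\<in>verts G.
         \<forall>\<sigma>\<in>arcs_from_to G i j. \<forall>\<rho>\<in>arcs_from_to G j k. \<forall>\<gamma>\<in>arcs_from_to G k i.
           W1 \<sigma> \<rho> \<gamma> =
             (\<Sum>\<sigma>'\<in>arcs_from_to G i j. \<Sum>\<rho>'\<in>arcs_from_to G j k. \<Sum>\<gamma>'\<in>arcs_from_to G k i.
                u \<sigma> \<sigma>' * u \<rho> \<rho>' * u \<gamma> \<gamma>' * W2 \<sigma>' \<rho>' \<gamma>')))"

section \<open>The graph \<open>A^(4n+2)*\<close> and its two cell systems\<close>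

definition A_star :: "nat \<Rightarrow> (nat, nat \<times> nat) pre_digraph" where
  "A_star n =
     \<lparr> verts = {1..2*n},
       arcs = {(i, i) | i. i \<in> {1..2*n}} \<union>
              {(i, i+1) | i. i \<in> {1..2*n-1}} \<union> {(i+1, i) | i. i \<in> {1..2*n-1}},
       tail = fst, head = snd \<rparr>"

definition q_star :: "nat \<Rightarrow> complex" where
  "q_star n = exp (of_real pi * \<i> / of_nat (4*n+2))"

abbreviation qnum :: "nat \<Rightarrow> nat \<Rightarrow> real" where
  "qnum n m \<equiv> qint (q_star n) (int m)"

definition phi_star :: "nat \<Rightarrow> nat \<Rightarrow> real" where
  "phi_star n i = qnum n (2*i) / qnum n 2"

text \<open>
  In the next three definitions \<open>s = 1\<close> selects the upper sign and \<open>s = -1\<close> the lower one. The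
  subtractions of naturals in \<open>cell_iii\<close> are exact since \<open>1 \<le> i \<le> 2*n\<close> at every vertex.
\<close>

definition cell_iij :: "nat \<Rightarrow> real \<Rightarrow> nat \<Rightarrow> real" where
  "cell_iij n s i =
     sqrt (qnum n (2*i) * qnum n (2*i+2)) / (qnum n 2 * sqrt (qnum n (2*i+1)))
       * sqrt (qnum n (2*i) - s * qnum n 1)"

definition cell_ijj :: "nat \<Rightarrow> real \<Rightarrow> nat \<Rightarrow> real" where
  "cell_ijj n s i =
     sqrt (qnum n (2*i) * qnum n (2*i+2)) / (qnum n 2 * sqrt (qnum n (2*i+1)))
       * sqrt (qnum n (2*i+2) + s * qnum n 1)"

definition cell_iii :: "nat \<Rightarrow> real \<Rightarrow> nat \<Rightarrow> real" where
  "cell_iii n s i =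
     (-1) ^ (i+1) * (sqrt (qnum n (2*i)) / (qnum n 2 * sqrt (qnum n (2*i-1) * qnum n (2*i+1))))
       * (if i \<le> n then sqrt (qnum n 2 * qnum n (2*i) + s * qnum n (4*i))
          else sqrt (qnum n 2 * qnum n (2*i) - s * qnum n (8*n+4-4*i)))"

text \<open>
  With \<open>i\<close> the least vertex of a triangle, the triangle is a rotation of exactly one of
  \<open>i,i,i\<close>, \<open>i,i,i+1\<close> and \<open>i,i+1,i+1\<close>.
\<close>

definition vertex_cell :: "nat \<Rightarrow> real \<Rightarrow> nat \<Rightarrow> nat \<Rightarrow> nat \<Rightarrow> real" where
  "vertex_cell n s a b c =
     (let i = min a (min b c) in
      if (a, b, c) = (i, i, i) then cell_iii n s i
      else if (a, b, c) \<in> {(i, i, i+1), (i, i+1, i), (i+1, i, i)} then cell_iij n s i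
      else if (a, b, c) \<in> {(i, i+1, i+1), (i+1, i+1, i), (i+1, i, i+1)} then cell_ijj n s i
      else 0)"

definition W_star :: "nat \<Rightarrow> real \<Rightarrow> nat \<times> nat \<Rightarrow> nat \<times> nat \<Rightarrow> nat \<times> nat \<Rightarrow> complex" where
  "W_star n s \<alpha> \<beta> \<gamma> = complex_of_real (vertex_cell n s (fst \<alpha>) (fst \<beta>) (fst \<gamma>))"

lemma W_star_values:
  "W_star n s (i, i) (i, i) (i, i) = complex_of_real (cell_iii n s i)"
  "W_star n s (i, i) (i, i+1) (i+1, i) = complex_of_real (cell_iij n s i)"
  "W_star n s (i, i+1) (i+1, i+1) (i+1, i) = complex_of_real (cell_ijj n s i)"
  by (simp_all add: W_star_def vertex_cell_def)

abbreviation W_plus where "W_plus n \<equiv> W_star n 1"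
abbreviation W_minus where "W_minus n \<equiv> W_star n (-1)"

end

theory Submission
  imports Defs
begin

text \<open>
  The graph has at most one edge from one vertex to another, so a cell system is a function on triples
  of vertices, and up to rotation its values are \<open>a_i = W_{i,i,i}\<close>, \<open>b_i = W_{i,i,i+1}\<close> and
  \<open>c_i = W_{i,i+1,i+1}\<close>. An equivalence multiplies these values by phases.

  Write \<open>d = [2]\<close> and \<open>|b_i|\<^sup>2 = \<phi>_i \<phi>_{i+1} u_i\<close>. Condition (I) on the edge \<open>{i,i+1}\<close> says
  \<open>|c_i|\<^sup>2 = \<phi>_i \<phi>_{i+1} (d - u_i)\<close>, and condition (II) on the path \<open>i, i+1, i+2\<close> says
  \<open>u_{i+1} (d - u_i) = 1\<close>. Hence \<open>u_1\<close> determines all \<open>u_i\<close>, and condition (I) on the loops then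
  determines \<open>|a_i|\<close>. Condition (II) on the edge \<open>{1,2}\<close> is a quadratic equation for \<open>u_1\<close> with the roots
  \<open>1/(d+1)\<close> and \<open>1/(d-1)\<close>. The solution of the recursion is \<open>u_i = ([2i] - s)/[2i+1]\<close>, where the sign
  \<open>s\<close> selects the root; it is called \<open>weight\<close> below. So each cell system has the moduli of one of the two
  given ones (lemma \<open>moduli\<close>).

  The phases of \<open>a_1\<close> and of all \<open>b_i\<close> and \<open>c_i\<close> can be prescribed by an equivalence. Condition (II) on
  \<open>i, i, i+1, i+1\<close> has right-hand side zero and expresses \<open>a_{i+1}\<close> through \<open>a_i\<close>, \<open>b_i\<close>, \<open>c_i\<close>, which
  fixes the phases of the remaining loop cells; its real form forces the alternating signs
  (lemma \<open>cell_system_equivalent\<close>).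

  Conversely the two given functions are cell systems (lemma \<open>cell_system_W_star\<close>). In terms of the
  weights, all instances of (I) and (II) follow from \<open>u_{i+1} (d - u_i) = 1\<close>, from
  \<open>u_i (\<phi>_i + \<phi>_{i+1}) = d \<phi>_i - s\<close>, from the eigenvector equation and from the alternating signs of
  the loop cells. They are inequivalent because \<open>|b_1|\<close> differs.
\<close>

section \<open>Quantum integers as ratios of sines\<close>

definition qsin :: "nat \<Rightarrow> nat \<Rightarrow> real" where
  "qsin n m = sin (real m * (pi / real (4*n+2))) / sin (pi / real (4*n+2))"

lemma qint_cis: "qint (cis t) m = sin (of_int m * t) / sin t"
proof -
  have p: "cis t powi k = cis (of_int k * t)" for k
    by (simp add: cis_power_int)
  have d: "cis x - cis (- x) = complex_of_real (2 * sin x) * \<i>" for x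
    by (simp add: complex_eq_iff)
  have "qint_complex (cis t) m
      = (complex_of_real (2 * sin (of_int m * t)) * \<i>) / (complex_of_real (2 * sin t) * \<i>)"
    unfolding qint_complex_def p using d[of "of_int m * t"] d[of t] by simp
  also have "\<dots> = complex_of_real (sin (of_int m * t) / sin t)"
    by (simp add: field_simps)
  finally show ?thesis
    unfolding qint_def by simp
qed

lemma q_star_cis: "q_star n = cis (pi / real (4*n+2))"
proof -
  have "of_real pi * \<i> / of_nat (4*n+2) = \<i> * complex_of_real (pi / real (4*n+2))"
    unfolding of_real_divide of_real_of_nat_eq by (simp only: times_divide_eq_right mult.commute)
  then show ?thesis unfolding q_star_def cis_conv_exp by (simp only:)
qed

lemma qnum_qsin: "qnum n m = qsin n m"
  unfolding q_star_cis qint_cis qsin_def by simp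

lemma angle_sin_pos: "sin (pi / real (4*n+2)) > 0"
  by (intro sin_gt_zero) (auto simp: field_simps intro!: add_pos_nonneg)

lemma qsin_0 [simp]: "qsin n 0 = 0"
  by (simp add: qsin_def)

lemma qsin_1 [simp]: "qsin n (Suc 0) = 1"
  using angle_sin_pos[of n] by (simp add: qsin_def)

lemma qsin_top: "qsin n (4*n+2) = 0"
proof -
  have "real (4*n+2) * (pi / real (4*n+2)) = pi"
    by (subst nonzero_mult_div_cancel_left[symmetric]) auto
  then show ?thesis by (simp only: qsin_def) simp
qed

lemma qsin_pos:
  assumes "0 < m" "m < 4*n+2"
  shows "0 < qsin n m"
proof -
  have "real m * (pi / real (4*n+2)) < real (4*n+2) * (pi / real (4*n+2))"
    using assms by (intro mult_strict_right_mono) auto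
  also have "\<dots> = pi" by simp
  finally have "0 < sin (real m * (pi / real (4*n+2)))"
    using assms by (intro sin_gt_zero) auto
  then show ?thesis
    unfolding qsin_def using angle_sin_pos by (rule divide_pos_pos)
qed

lemma qsin_2_cos: "qsin n 2 = 2 * cos (pi / real (4*n+2))"
proof -
  define t where "t = pi / real (4*n+2)"
  have "sin t \<noteq> 0" using angle_sin_pos[of n] by (simp add: t_def)
  then show ?thesis
    unfolding qsin_def t_def[symmetric] by (simp add: sin_double)
qed

lemma qsin_2_less: "qsin n 2 < 2"
proof -
  have "cos (pi / real (4*n+2)) < cos 0"
    by (intro cos_monotone_0_pi) (auto simp: field_simps intro!: add_pos_nonneg)
  then show ?thesis by (simp add: qsin_2_cos)
qed

lemma qsin_recurrence: "qsin n (m+2) + qsin n m = qsin n 2 * qsin n (m+1)"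
proof -
  define t where "t = pi / real (4*n+2)"
  have "sin (real (m+2) * t) + sin (real m * t) = 2 * cos t * sin (real (m+1) * t)"
    using sin_add[of "real (m+1) * t" t] sin_diff[of "real (m+1) * t" t]
    by (simp add: algebra_simps)
  then show ?thesis
    unfolding qsin_2_cos unfolding qsin_def t_def[symmetric]
    by (metis add_divide_distrib times_divide_eq_right)
qed

text \<open>
  This is \<open>sin (x + t) sin (x - t) = sin\<^sup>2 x - sin\<^sup>2 t\<close>. It gives the edge
  weights their multiplicative recursion, as the three-term recurrence makes \<open>[2] - weight i\<close> explicit.
\<close>

lemma qsin_neighbours: "qsin n (m+2) * qsin n m = (qsin n (m+1))\<^sup>2 - 1"
proof -
  define t where "t = pi / real (4*n+2)"
  have t: "sin t \<noteq> 0" using angle_sin_pos[of n] by (simp add: t_def)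
  define x where "x = real (m+1) * t"
  have e: "real (m+2) * t = x + t" "real m * t = x - t"
    by (simp_all add: x_def algebra_simps)
  have "sin (x + t) * sin (x - t) = (sin x)\<^sup>2 - (sin t)\<^sup>2"
    unfolding sin_add sin_diff using sin_cos_squared_add[of x] sin_cos_squared_add[of t]
    by algebra
  then show ?thesis
    unfolding qsin_def t_def[symmetric] e x_def[symmetric] using t
    by (simp add: field_simps power2_eq_square)
qed

lemma qsin_double: "qsin n (2*m+2) = qsin n (m+1) * (qsin n (m+2) - qsin n m)"
proof -
  define t where "t = pi / real (4*n+2)"
  have t: "sin t \<noteq> 0" using angle_sin_pos[of n] by (simp add: t_def)
  define x where "x = real (m+1) * t"
  have e: "real (m+2) * t = x + t" "real m * t = x - t" "real (2*m+2) * t = 2 * x"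
    by (simp_all add: x_def algebra_simps)
  have "sin (2 * x) * sin t = sin x * (sin (x + t) - sin (x - t))"
    unfolding sin_add sin_diff sin_double by algebra
  then show ?thesis
    unfolding qsin_def t_def[symmetric] e x_def[symmetric] using t
    by (simp add: field_simps)
qed

text \<open>
  By periodicity of the sine, the values \<open>[8n+4-4i]\<close> in the loop cells beyond the middle of the graph are \<open>- [4i]\<close>, so that a
  single formula describes the loop cells at all vertices.
\<close>

lemma qsin_reflect:
  assumes "m \<le> 8*n+4"
  shows "qsin n (8*n+4-m) = - qsin n m"
proof -
  define t where "t = pi / real (4*n+2)"
  have "real (8*n+4) * t = 2 * pi"
    unfolding t_def by (simp add: field_simps)
  then have "real (8*n+4-m) * t = 2 * pi - real m * t"
    using assms by (simp add: of_nat_diff left_diff_distrib)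
  then show ?thesis
    unfolding qsin_def t_def[symmetric] by (simp add: sin_diff)
qed

section \<open>The eigenvector\<close>

lemma phi_star_eq: "phi_star n i = qsin n (2*i) / qsin n 2"
  unfolding phi_star_def qnum_qsin ..

lemma qsin_2_pos: "0 < n \<Longrightarrow> 0 < qsin n 2"
  by (rule qsin_pos) auto

lemma phi_star_0 [simp]: "phi_star n 0 = 0"
  by (simp add: phi_star_eq)

text \<open>
  Together with the value at \<open>0\<close> this makes the eigenvector vanish on both sides of the graph, so that
  sums over neighbours need no case distinction at the two end vertices.
\<close>

lemma phi_star_top [simp]: "phi_star n (Suc (2*n)) = 0"
  using qsin_top[of n] by (simp add: phi_star_eq algebra_simps)

lemma phi_star_pos: "i \<in> {1..2*n} \<Longrightarrow> 0 < phi_star n i"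
  unfolding phi_star_eq by (intro divide_pos_pos qsin_pos) auto

lemma phi_star_add_Suc:
  assumes "0 < n"
  shows "phi_star n i + phi_star n (Suc i) = qsin n (2*i+1)"
  using qsin_recurrence[of n "2*i"] qsin_2_pos[OF assms]
  by (simp add: phi_star_eq field_simps)

lemma phi_star_recurrence:
  assumes "0 < n"
  shows "phi_star n i + 2 * phi_star n (Suc i) + phi_star n (Suc (Suc i))
       = (qsin n 2)\<^sup>2 * phi_star n (Suc i)"
  using phi_star_add_Suc[OF assms, of i] phi_star_add_Suc[OF assms, of "Suc i"]
    qsin_recurrence[of n "2*i+1"] qsin_2_pos[OF assms]
  by (simp add: phi_star_eq[of n "Suc i"] power2_eq_square numeral_eq_Suc)

lemma odd_pos: "i \<le> 2*n \<Longrightarrow> 0 < qsin n (2*i+1)"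
  by (rule qsin_pos) auto

lemma even_gt_1:
  assumes "i \<in> {1..2*n}" shows "1 < qsin n (2*i)"
proof -
  have "0 < qsin n (2*i+1) * qsin n (2*i-1)"
    using assms by (intro mult_pos_pos qsin_pos) auto
  also have "\<dots> = (qsin n (2*i))\<^sup>2 - 1"
    using qsin_neighbours[of n "2*i-1"] assms by simp
  finally have "1\<^sup>2 < (qsin n (2*i))\<^sup>2" by simp
  then show ?thesis
    using qsin_pos[of "2*i" n] assms by (intro power2_less_imp_less[of 1]) auto
qed

section \<open>Edge weights and the squares of the cells\<close>

text \<open>
  The ratio \<open>W_{i,i,i+1}\<^sup>2 / (\<phi>_i \<phi>_{i+1})\<close> for the cell system of sign \<open>s\<close>. Condition (I) on the edge
  \<open>{i, i+1}\<close> makes \<open>[2] - weight i\<close> the same ratio for \<open>W_{i,i+1,i+1}\<close>, and the loop cell at \<open>i\<close> is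
  governed by \<open>weight i - weight (i-1)\<close>.
\<close>

definition weight :: "nat \<Rightarrow> real \<Rightarrow> nat \<Rightarrow> real" where
  "weight n s i = (qsin n (2*i) - s) / qsin n (2*i+1)"

lemma weight_times:
  assumes "0 < n" "i \<le> 2*n"
  shows "weight n s i * (phi_star n i + phi_star n (Suc i)) = qsin n 2 * phi_star n i - s"
  using odd_pos[OF assms(2)] qsin_2_pos[OF assms(1)] unfolding phi_star_add_Suc[OF assms(1)]
  by (simp add: weight_def phi_star_eq)

lemma coweight:
  assumes "i \<le> 2*n"
  shows "qsin n 2 - weight n s i = (qsin n (2*i+2) + s) / qsin n (2*i+1)"
  using odd_pos[OF assms] qsin_recurrence[of n "2*i"]
  by (simp add: weight_def field_simps)

lemma coweight_times:
  assumes "0 < n" "i \<le> 2*n"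
  shows "(qsin n 2 - weight n s i) * (phi_star n i + phi_star n (Suc i))
       = qsin n 2 * phi_star n (Suc i) + s"
  using weight_times[OF assms] by (simp add: algebra_simps)

lemma square_sqrt_quotient:
  assumes "0 \<le> a" "0 \<le> b" "(0::real) \<le> p"
  shows "(sqrt a / (d * sqrt p) * sqrt b)\<^sup>2 = a / (d * d) * (b / p)"
proof -
  have "(sqrt a / (d * sqrt p) * sqrt b)\<^sup>2
      = (sqrt a)\<^sup>2 * (sqrt b)\<^sup>2 / (d\<^sup>2 * (sqrt p)\<^sup>2)"
    by (simp only: power_mult_distrib power_divide times_divide_eq_left)
  also have "\<dots> = a * b / (d\<^sup>2 * p)" using assms by simp
  finally show ?thesis by (simp add: power2_eq_square)
qed

context
  fixes n :: nat and s :: real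
  assumes n: "0 < n" and s: "s = 1 \<or> s = -1"
begin

text \<open>
  Condition (II) along a path of three vertices imposes exactly this recursion. It holds because
  \<open>([2i] - s) ([2i] + s) = [2i]\<^sup>2 - 1 = [2i-1] [2i+1]\<close>. It extends to \<open>i = 0\<close>, where \<open>weight 0 = - s\<close>.
\<close>

lemma weight_step:
  assumes "i < 2*n"
  shows "weight n s (Suc i) * (qsin n 2 - weight n s i) = 1"
proof -
  have "(qsin n (2*i+2))\<^sup>2 - 1 = qsin n (2*i+3) * qsin n (2*i+1)"
    using qsin_neighbours[of n "2*i+1"] by (simp add: numeral_eq_Suc)
  moreover have "s * s = 1" using s by auto
  ultimately have "(qsin n (2*i+2) - s) * (qsin n (2*i+2) + s) = qsin n (2*i+3) * qsin n (2*i+1)"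
    by (simp add: algebra_simps power2_eq_square)
  moreover have "weight n s (Suc i) = (qsin n (2*i+2) - s) / qsin n (2*i+3)"
    by (simp add: weight_def numeral_eq_Suc)
  moreover have "0 < qsin n (2*i+1)" "0 < qsin n (2*i+3)"
    using assms by (auto intro!: qsin_pos)
  ultimately show ?thesis
    using assms by (simp add: coweight)
qed

lemma weight_pos: "i \<in> {1..2*n} \<Longrightarrow> 0 < weight n s i"
  using even_gt_1[of i n] odd_pos[of i n] s by (auto simp: weight_def intro!: divide_pos_pos)

lemma coweight_pos:
  assumes "i < 2*n" shows "0 < qsin n 2 - weight n s i"
  using weight_pos[of "Suc i"] weight_step[OF assms] assms
  by (metis Suc_leI atLeastAtMost_iff le_add1 plus_1_eq_Suc zero_less_mult_pos zero_less_one)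

lemma loop_weight:
  assumes "i < 2*n"
  shows "weight n s (Suc i) - weight n s i
       = (qsin n 2 + s * (qsin n (2*i+3) - qsin n (2*i+1))) / (qsin n (2*i+1) * qsin n (2*i+3))"
proof -
  define p m y where "p = qsin n (2*i+3)" and "m = qsin n (2*i+1)" and "y = qsin n (2*i+2)"
  have pos: "0 < p" "0 < m" unfolding p_def m_def using assms by (auto intro!: qsin_pos)
  have sum: "p + m = qsin n 2 * y" and prd: "p * m = y\<^sup>2 - 1"
    unfolding p_def m_def y_def
    using qsin_recurrence[of n "2*i+1"] qsin_neighbours[of n "2*i+1"]
    by (simp_all add: numeral_eq_Suc)
  have "weight n s (Suc i) = (y - s) / p"
    by (simp add: weight_def p_def y_def numeral_eq_Suc)
  moreover have "qsin n 2 - weight n s i = (y + s) / m"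
    using assms by (simp add: coweight y_def m_def)
  ultimately have "weight n s (Suc i) - weight n s i = (y - s) / p + (y + s) / m - qsin n 2"
    by simp
  also have "\<dots> = ((y - s) * m + (y + s) * p - qsin n 2 * (p * m)) / (m * p)"
    using pos by (simp add: field_simps)
  also have "(y - s) * m + (y + s) * p - qsin n 2 * (p * m) = qsin n 2 + s * (p - m)"
    using sum prd by algebra
  finally show ?thesis by (simp add: p_def m_def)
qed

text \<open>
  With \<open>p = [2i+3]\<close>, \<open>m = [2i+1]\<close>, \<open>y = [2i+2]\<close> and \<open>d = [2]\<close>, the relations \<open>p + m = d y\<close> and
  \<open>p m = y\<^sup>2 - 1\<close> give \<open>d\<^sup>2 - (p - m)\<^sup>2 = (4 - d\<^sup>2) (y\<^sup>2 - 1)\<close>, which is positive as \<open>d < 2\<close> and \<open>y > 1\<close>.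
\<close>

lemma loop_numerator_pos:
  assumes "i < 2*n"
  shows "0 < qsin n 2 + s * (qsin n (2*i+3) - qsin n (2*i+1))"
proof -
  define p m y d where "p = qsin n (2*i+3)" and "m = qsin n (2*i+1)" and "y = qsin n (2*i+2)"
    and "d = qsin n 2"
  have sum: "p + m = d * y" and prd: "p * m = y\<^sup>2 - 1"
    unfolding p_def m_def y_def d_def
    using qsin_recurrence[of n "2*i+1"] qsin_neighbours[of n "2*i+1"]
    by (simp_all add: numeral_eq_Suc)
  have d: "0 < d" "d < 2" using qsin_2_pos[OF n] qsin_2_less[of n] by (simp_all add: d_def)
  have y: "1 < y" using even_gt_1[of "Suc i" n] assms by (simp add: y_def)
  have "d\<^sup>2 - (p - m)\<^sup>2 = (2\<^sup>2 - d\<^sup>2) * (y\<^sup>2 - 1)"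
    using sum prd by algebra
  also have "\<dots> > 0"
  proof (intro mult_pos_pos)
    show "0 < 2\<^sup>2 - d\<^sup>2" using power_strict_mono[OF d(2), of 2] d(1) by (simp only: diff_gt_0_iff_gt)
    show "0 < y\<^sup>2 - 1" using one_less_power[OF y, of 2] by simp
  qed
  finally have "\<bar>p - m\<bar>\<^sup>2 < d\<^sup>2" by (simp only: power2_abs diff_gt_0_iff_gt)
  then have "\<bar>p - m\<bar> < d"
    using d(1) by (rule power2_less_imp_less[OF _ less_imp_le])
  then show ?thesis using s by (auto simp: p_def m_def d_def)
qed

lemma weight_strict_mono:
  assumes "i < 2*n"
  shows "weight n s i < weight n s (Suc i)"
proof -
  have "0 < weight n s (Suc i) - weight n s i"
    unfolding loop_weight[OF assms] using loop_numerator_pos[OF assms] assms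
    by (intro divide_pos_pos mult_pos_pos qsin_pos) auto
  then show ?thesis by simp
qed

lemma cell_iij_square:
  assumes "i \<in> {1..2*n}"
  shows "(cell_iij n s i)\<^sup>2 = phi_star n i * phi_star n (Suc i) * weight n s i"
proof -
  have "0 \<le> qsin n (2*i) * qsin n (2*i+2)"
    using assms qsin_pos[of "2*i" n] qsin_pos[of "2*i+2" n] qsin_top[of n]
    by (cases "i = 2*n") auto
  moreover have "0 \<le> qsin n (2*i) - qsin n 1 * s" using even_gt_1[OF assms] s by auto
  moreover have "0 \<le> qsin n (2*i+1)" using odd_pos[of i n] assms by simp
  ultimately have "(cell_iij n s i)\<^sup>2
      = qsin n (2*i) * qsin n (2*i+2) / (qsin n 2 * qsin n 2) * weight n s i"
    unfolding cell_iij_def qnum_qsin weight_def by (subst square_sqrt_quotient) (auto simp: mult.commute)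
  then show ?thesis by (simp add: phi_star_eq)
qed

lemma cell_ijj_square:
  assumes "i < 2*n"
  shows "(cell_ijj n s i)\<^sup>2 = phi_star n i * phi_star n (Suc i) * (qsin n 2 - weight n s i)"
proof -
  have "0 \<le> qsin n (2*i) * qsin n (2*i+2)"
    using assms qsin_pos[of "2*i" n] qsin_pos[of "2*i+2" n]
    by (cases "i = 0") auto
  moreover have "0 \<le> qsin n (2*i+2) + qsin n 1 * s" using even_gt_1[of "Suc i" n] assms s by auto
  moreover have "0 \<le> qsin n (2*i+1)" using odd_pos[of i n] assms by simp
  ultimately have "(cell_ijj n s i)\<^sup>2
      = qsin n (2*i) * qsin n (2*i+2) / (qsin n 2 * qsin n 2) * (qsin n 2 - weight n s i)"
    unfolding cell_ijj_def qnum_qsin coweight[OF less_imp_le[OF assms]]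
    by (subst square_sqrt_quotient) (auto simp: mult.commute)
  then show ?thesis by (simp add: phi_star_eq)
qed

text \<open>
  Both branches in the definition of the loop cell agree with this formula, by
  \<open>[4i] = [2i] ([2i+1] - [2i-1])\<close> and the reflection of \<open>[8n+4-4i]\<close>.
\<close>

lemma cell_iii_eq:
  assumes "i < 2*n"
  shows "cell_iii n s (Suc i)
       = (-1) ^ i * phi_star n (Suc i) * sqrt (weight n s (Suc i) - weight n s i)"
proof -
  define p m y d where "p = qsin n (2*i+3)" and "m = qsin n (2*i+1)" and "y = qsin n (2*i+2)"
    and "d = qsin n 2"
  have pos: "0 < p" "0 < m" "0 < y" "0 < d"
    unfolding p_def m_def y_def d_def using assms n by (auto intro!: qsin_pos)
  have e: "2*(2*i+1)+2 = 4*Suc i" "2*i+1+1 = 2*i+2" "2*i+1+2 = 2*i+3"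
    "2*Suc i = 2*i+2" "2*i+2-1 = 2*i+1" "2*i+2+1 = 2*i+3" by simp_all
  have four: "qsin n (4*Suc i) = y * (p - m)"
    using qsin_double[of n "2*i+1"] unfolding y_def p_def m_def by (simp only: e)
  then have reflected: "qsin n (8*n+4-4*Suc i) = - (y * (p - m))"
    using qsin_reflect[of "4*Suc i" n] assms by simp
  have "cell_iii n s (Suc i)
      = (-1) ^ i * (sqrt y / (d * sqrt (m * p)) * sqrt (d * y + s * (y * (p - m))))"
    unfolding cell_iii_def qnum_qsin four reflected
    unfolding e y_def p_def m_def d_def by simp
  also have "d * y + s * (y * (p - m)) = y * (d + s * (p - m))"
    by (simp add: algebra_simps)
  also have "sqrt y / (d * sqrt (m * p)) * sqrt (y * (d + s * (p - m)))
      = sqrt y * sqrt y / d * (sqrt (d + s * (p - m)) / sqrt (m * p))"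
    by (simp add: real_sqrt_mult[of y])
  also have "sqrt (d + s * (p - m)) / sqrt (m * p) = sqrt (weight n s (Suc i) - weight n s i)"
    unfolding loop_weight[OF assms] real_sqrt_divide by (simp add: p_def m_def d_def)
  also have "sqrt y * sqrt y / d = phi_star n (Suc i)"
    using pos by (simp add: phi_star_eq y_def d_def)
  finally show ?thesis by simp
qed

lemma cell_iii_square:
  assumes "i < 2*n"
  shows "(cell_iii n s (Suc i))\<^sup>2 = (phi_star n (Suc i))\<^sup>2 * (weight n s (Suc i) - weight n s i)"
proof -
  have sign: "((-1) ^ i)\<^sup>2 = (1::real)" by (cases "even i") auto
  show ?thesis
    unfolding cell_iii_eq[OF assms] power_mult_distrib sign
    using weight_strict_mono[OF assms] by simp
qed

lemma cell_nonneg: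
  assumes "i \<in> {1..<2*n}"
  shows "0 \<le> cell_iij n s i" "0 \<le> cell_ijj n s i"
proof -
  have "0 \<le> qsin n (2*i) * qsin n (2*i+2)" "0 \<le> qsin n (2*i+1)" "0 \<le> qsin n 2"
    using assms qsin_pos[of "2*i" n] qsin_pos[of "2*i+1" n] qsin_pos[of "2*i+2" n] qsin_2_pos[OF n]
    by auto
  moreover have "0 \<le> qsin n (2*i) - s * qsin n 1" "0 \<le> qsin n (2*i+2) + s * qsin n 1"
    using even_gt_1[of i n] even_gt_1[of "Suc i" n] assms s by auto
  ultimately show "0 \<le> cell_iij n s i" "0 \<le> cell_ijj n s i"
    unfolding cell_iij_def cell_ijj_def qnum_qsin
    by - (assumption | rule mult_nonneg_nonneg divide_nonneg_nonneg real_sqrt_ge_zero)+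
qed

end

section \<open>Cell systems on the graph as functions of vertices\<close>

definition near :: "nat \<Rightarrow> nat \<Rightarrow> bool" where
  "near i j \<longleftrightarrow> i \<le> Suc j \<and> j \<le> Suc i"

lemma near_refl [simp]: "near i i" and near_Suc [simp]: "near i (Suc i)" "near (Suc i) i"
  by (simp_all add: near_def)

lemma near_sym: "near i j \<Longrightarrow> near j i"
  by (simp add: near_def)

lemma near_cases:
  assumes "near i j"
  obtains "j = i" | "j = Suc i" | "i = Suc j"
  using assms unfolding near_def by linarith

lemma verts_A_star [simp]: "verts (A_star n) = {1..2*n}"
  by (simp add: A_star_def)

lemma arcs_A_star: "arcs (A_star n) = {(i, j). i \<in> {1..2*n} \<and> j \<in> {1..2*n} \<and> near i j}"
proof -
  have "(i, j) \<in> arcs (A_star n) \<longleftrightarrow> (j = i \<and> 1 \<le> i \<and> i \<le> 2*n)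
      \<or> (j = i+1 \<and> 1 \<le> i \<and> i \<le> 2*n-1) \<or> (i = j+1 \<and> 1 \<le> j \<and> j \<le> 2*n-1)" for i j
    unfolding A_star_def by auto
  also have "\<dots> i j \<longleftrightarrow> i \<in> {1..2*n} \<and> j \<in> {1..2*n} \<and> near i j" for i j
    unfolding near_def atLeastAtMost_iff by presburger
  finally show ?thesis by auto
qed

lemma arcs_from_to_A_star:
  "arcs_from_to (A_star n) i j
     = (if i \<in> {1..2*n} \<and> j \<in> {1..2*n} \<and> near i j then {(i, j)} else {})"
  unfolding arcs_from_to_def arcs_A_star by (auto simp: A_star_def)

lemma fin_digraph_A_star: "fin_digraph (A_star n)"
proof -
  have "arcs (A_star n) \<subseteq> {1..2*n} \<times> {1..2*n}" by (auto simp: arcs_A_star)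
  then have "finite (arcs (A_star n))" by (rule finite_subset) simp
  then show ?thesis
    by unfold_locales (auto simp: arcs_A_star, auto simp: A_star_def)
qed

text \<open>
  The two conditions and the eigenvector equation sum over all vertices, but only the three neighbours of a
  vertex contribute. A summand that vanishes at the two fictitious vertices \<open>0\<close> and \<open>2n+1\<close> needs no
  separate treatment at the ends.
\<close>

lemma sum_near:
  fixes f :: "nat \<Rightarrow> 'a::comm_monoid_add"
  assumes i: "i < 2*n"
    and far: "\<And>k. k \<in> {1..2*n} \<Longrightarrow> \<not> near (Suc i) k \<Longrightarrow> f k = 0"
    and ends: "f 0 = 0" "f (Suc (2*n)) = 0"
  shows "(\<Sum>k\<in>{1..2*n}. f k) = f i + f (Suc i) + f (Suc (Suc i))"
proof -
  have "(\<Sum>k\<in>{1..2*n}. f k) = (\<Sum>k\<in>{0..Suc (2*n)}. f k)"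
    by (intro sum.mono_neutral_left) (auto simp: ends not_le le_Suc_eq)
  also have "\<dots> = (\<Sum>k\<in>{i, Suc i, Suc (Suc i)}. f k)"
  proof (intro sum.mono_neutral_right ballI)
    fix k assume k: "k \<in> {0..Suc (2*n)} - {i, Suc i, Suc (Suc i)}"
    show "f k = 0"
    proof (cases "k \<in> {1..2*n}")
      case True
      then show ?thesis using k by (intro far) (auto simp: near_def)
    next
      case False
      with k have "k = 0 \<or> k = Suc (2*n)" by auto
      then show ?thesis using ends by auto
    qed
  qed (use i in auto)
  also have "\<dots> = f i + f (Suc i) + f (Suc (Suc i))" by (simp add: add.assoc)
  finally show ?thesis .
qed

text \<open>
  No ordered pair of vertices carries two edges, so a triangle is given by its vertices. Extending by
  zero to all other triples removes the adjacency conditions from the sums in (I) and (II).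
\<close>

definition vertex_form ::
    "nat \<Rightarrow> (nat \<times> nat \<Rightarrow> nat \<times> nat \<Rightarrow> nat \<times> nat \<Rightarrow> complex) \<Rightarrow> nat \<Rightarrow> nat \<Rightarrow> nat \<Rightarrow> complex" where
  "vertex_form n W i j k =
     (if i \<in> {1..2*n} \<and> j \<in> {1..2*n} \<and> k \<in> {1..2*n} \<and> near i j \<and> near j k \<and> near k i
      then W (i, j) (j, k) (k, i) else 0)"

lemma vertex_form_eq_0:
  "\<not> near i j \<or> \<not> near j k \<or> \<not> near k i \<Longrightarrow> vertex_form n W i j k = 0"
  by (auto simp: vertex_form_def)

lemma ball_arcs_from_to_A_star:
  "(\<forall>e\<in>arcs_from_to (A_star n) i j. P e)
     \<longleftrightarrow> (i \<in> {1..2*n} \<longrightarrow> j \<in> {1..2*n} \<longrightarrow> near i j \<longrightarrow> P (i, j))"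
  by (simp add: arcs_from_to_A_star)

lemma sum_arcs_from_to_A_star:
  "(\<Sum>e\<in>arcs_from_to (A_star n) i j. f e)
     = (if i \<in> {1..2*n} \<and> j \<in> {1..2*n} \<and> near i j then f (i, j) else 0)"
  by (simp add: arcs_from_to_A_star)

lemma cell_condition_I_A_star:
  "cell_condition_I (A_star n) q \<phi> W \<longleftrightarrow>
     (\<forall>i\<in>{1..2*n}. \<forall>j\<in>{1..2*n}. near i j \<longrightarrow>
        (\<Sum>k\<in>{1..2*n}. vertex_form n W i j k * cnj (vertex_form n W i j k))
          = complex_of_real (qint q 2 * \<phi> i * \<phi> j))"
proof -
  have "(\<Sum>k\<in>{1..2*n}. \<Sum>\<beta>\<in>arcs_from_to (A_star n) j k. \<Sum>\<gamma>\<in>arcs_from_to (A_star n) k i.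
          W (i, j) \<beta> \<gamma> * cnj (W (i, j) \<beta> \<gamma>))
      = (\<Sum>k\<in>{1..2*n}. vertex_form n W i j k * cnj (vertex_form n W i j k))"
    if "i \<in> {1..2*n}" "j \<in> {1..2*n}" "near i j" for i j
    unfolding sum_arcs_from_to_A_star
    by (rule sum.cong) (use that in \<open>auto simp: vertex_form_def\<close>)
  then show ?thesis
    unfolding cell_condition_I_def verts_A_star ball_arcs_from_to_A_star by auto
qed

lemma cell_condition_II_A_star:
  "cell_condition_II (A_star n) \<phi> W \<longleftrightarrow>
     (\<forall>x\<in>{1..2*n}. \<forall>y\<in>{1..2*n}. \<forall>z\<in>{1..2*n}. \<forall>t\<in>{1..2*n}.
        near x y \<longrightarrow> near z y \<longrightarrow> near z t \<longrightarrow> near x t \<longrightarrow>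
        (\<Sum>k\<in>{1..2*n}. complex_of_real (inverse (\<phi> k)) *
           vertex_form n W x y k * cnj (vertex_form n W z y k) *
           vertex_form n W z t k * cnj (vertex_form n W x t k))
        = (if y = t then complex_of_real (\<phi> x * \<phi> y * \<phi> z) else 0)
          + (if x = z then complex_of_real (\<phi> x * \<phi> y * \<phi> t) else 0))"
proof -
  have "(\<Sum>k\<in>{1..2*n}. \<Sum>\<beta>1\<in>arcs_from_to (A_star n) y k. \<Sum>\<beta>2\<in>arcs_from_to (A_star n) k x.
         \<Sum>\<beta>3\<in>arcs_from_to (A_star n) k z. \<Sum>\<beta>4\<in>arcs_from_to (A_star n) t k.
          complex_of_real (inverse (\<phi> k)) * W (x, y) \<beta>1 \<beta>2 * cnj (W (z, y) \<beta>1 \<beta>3) *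
          W (z, t) \<beta>4 \<beta>3 * cnj (W (x, t) \<beta>4 \<beta>2))
      = (\<Sum>k\<in>{1..2*n}. complex_of_real (inverse (\<phi> k)) *
           vertex_form n W x y k * cnj (vertex_form n W z y k) *
           vertex_form n W z t k * cnj (vertex_form n W x t k))"
    if "x \<in> {1..2*n}" "y \<in> {1..2*n}" "z \<in> {1..2*n}" "t \<in> {1..2*n}"
      "near x y" "near z y" "near z t" "near x t" for x y z t
    unfolding sum_arcs_from_to_A_star
  proof (rule sum.cong, goal_cases)
    case (2 k)
    show ?case
    proof (cases "near y k \<and> near k x \<and> near k z \<and> near t k")
      case True
      then show ?thesis using that 2 by (simp add: vertex_form_def)
    next
      case False
      then have "vertex_form n W x y k = 0 \<or> vertex_form n W z y k = 0
          \<or> vertex_form n W z t k = 0 \<or> vertex_form n W x t k = 0"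
        by (auto intro: vertex_form_eq_0)
      then show ?thesis using False by auto
    qed
  qed simp
  note key = this
  have swap: "x = z \<and> z = x \<longleftrightarrow> x = z" for x z :: nat by auto
  show ?thesis
    unfolding cell_condition_II_def verts_A_star ball_arcs_from_to_A_star
    by (intro ball_cong refl) (simp only: key prod.inject simp_thms swap cong: imp_cong)
qed

lemma vertex_form_rotate:
  assumes "rotation_invariant (A_star n) W"
  shows "vertex_form n W i j k = vertex_form n W j k i"
proof (cases "i \<in> {1..2*n} \<and> j \<in> {1..2*n} \<and> k \<in> {1..2*n} \<and> near i j \<and> near j k \<and> near k i")
  case True
  then have "triangle (A_star n) (i, j) (j, k) (k, i)"
    by (auto simp: triangle_def arcs_A_star) (simp_all add: A_star_def)
  then have "W (i, j) (j, k) (k, i) = W (j, k) (k, i) (i, j)"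
    using assms unfolding rotation_invariant_def by blast
  then show ?thesis using True by (simp add: vertex_form_def)
next
  case False
  then have "vertex_form n W i j k = 0" "vertex_form n W j k i = 0"
    unfolding vertex_form_def by metis+
  then show ?thesis by simp
qed

lemma unitary_on_arcs_from_to_A_star:
  assumes "i \<in> {1..2*n}" "j \<in> {1..2*n}"
  shows "unitary_on (arcs_from_to (A_star n) i j) u \<longleftrightarrow> near i j \<longrightarrow> cmod (u (i, j) (i, j)) = 1"
proof -
  have "z * cnj z = 1 \<longleftrightarrow> cmod z = 1" for z
  proof -
    have "z * cnj z = 1 \<longleftrightarrow> (cmod z)\<^sup>2 = 1"
      unfolding complex_norm_square[symmetric] by (metis of_real_1 of_real_eq_iff)
    also have "\<dots> \<longleftrightarrow> cmod z = 1"
      using norm_ge_zero[of z] unfolding power2_eq_1_iff by linarith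
    finally show ?thesis .
  qed
  moreover from this have "cnj z * z = 1 \<longleftrightarrow> cmod z = 1" for z
    by (simp add: mult.commute)
  ultimately show ?thesis
    using assms by (simp add: unitary_on_def arcs_from_to_A_star)
qed

text \<open>
  A unitary matrix on at most one edge is a phase, so equivalence is multiplication by one phase for
  each directed edge.
\<close>

lemma cell_equivalent_A_star:
  "cell_equivalent (A_star n) W1 W2 \<longleftrightarrow>
     (\<exists>u :: nat \<Rightarrow> nat \<Rightarrow> complex.
        (\<forall>i\<in>{1..2*n}. \<forall>j\<in>{1..2*n}. near i j \<longrightarrow> cmod (u i j) = 1) \<and>
        (\<forall>i\<in>{1..2*n}. \<forall>j\<in>{1..2*n}. \<forall>k\<in>{1..2*n}.
           vertex_form n W1 i j k = u i j * u j k * u k i * vertex_form n W2 i j k))"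
  (is "?L \<longleftrightarrow> (\<exists>u. ?unit u \<and> ?eq u)")
proof -
  have main: "(\<forall>i\<in>{1..2*n}. \<forall>j\<in>{1..2*n}. unitary_on (arcs_from_to (A_star n) i j) v) \<and>
        (\<forall>i\<in>{1..2*n}. \<forall>j\<in>{1..2*n}. \<forall>k\<in>{1..2*n}.
         \<forall>\<sigma>\<in>arcs_from_to (A_star n) i j. \<forall>\<rho>\<in>arcs_from_to (A_star n) j k.
         \<forall>\<gamma>\<in>arcs_from_to (A_star n) k i.
           W1 \<sigma> \<rho> \<gamma> =
             (\<Sum>\<sigma>'\<in>arcs_from_to (A_star n) i j. \<Sum>\<rho>'\<in>arcs_from_to (A_star n) j k.
              \<Sum>\<gamma>'\<in>arcs_from_to (A_star n) k i.
                v \<sigma> \<sigma>' * v \<rho> \<rho>' * v \<gamma> \<gamma>' * W2 \<sigma>' \<rho>' \<gamma>'))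
      \<longleftrightarrow> ?unit (\<lambda>i j. v (i, j) (i, j)) \<and> ?eq (\<lambda>i j. v (i, j) (i, j))" for v
    unfolding ball_arcs_from_to_A_star sum_arcs_from_to_A_star
    by (rule conj_cong; intro ball_cong refl)
      (auto simp: unitary_on_arcs_from_to_A_star vertex_form_def)
  show ?thesis
  proof
    assume ?L
    then obtain v where "?unit (\<lambda>i j. v (i, j) (i, j)) \<and> ?eq (\<lambda>i j. v (i, j) (i, j))"
      unfolding cell_equivalent_def verts_A_star main by (rule exE)
    then show "\<exists>u. ?unit u \<and> ?eq u"
      by (rule exI[of _ "\<lambda>i j. v (i, j) (i, j)"])
  next
    assume "\<exists>u. ?unit u \<and> ?eq u"
    then obtain u where u: "?unit u \<and> ?eq u" by blast
    show ?L
      unfolding cell_equivalent_def verts_A_star main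
      by (rule exI[of _ "\<lambda>e e'. u (fst e) (snd e)"]) (use u in simp)
  qed
qed

section \<open>Perron-Frobenius data\<close>

text \<open>
  The eigenvector equation is the recurrence for quantum integers, with the boundary terms \<open>[0]\<close> and
  \<open>[4n+2]\<close> vanishing. Any complex eigenvector \<open>x\<close> is dominated by a multiple of the positive
  eigenvector, with equality at some vertex, and there the eigenvalue equation bounds \<open>|\<mu>|\<close>.
\<close>

lemma perron_frobenius_A_star:
  assumes n: "0 < n"
  shows "perron_frobenius (A_star n) (qint (q_star n) 3) (phi_star n)"
proof -
  have qn3: "qint (q_star n) 3 = qsin n 3" using qnum_qsin[of n 3] by simp
  have three: "qsin n 3 = (qsin n 2)\<^sup>2 - 1"
    using qsin_neighbours[of n 1] by (simp add: eval_nat_numeral)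
  have sum_out: "(\<Sum>e\<in>out_arcs (A_star n) (Suc i). f (head (A_star n) e))
      = (\<Sum>k\<in>{1..2*n}. if near (Suc i) k then f k else 0)" if "i < 2*n"
    for i and f :: "nat \<Rightarrow> 'a::comm_monoid_add"
  proof -
    have "out_arcs (A_star n) (Suc i) = Pair (Suc i) ` {k \<in> {1..2*n}. near (Suc i) k}"
      unfolding out_arcs_def arcs_A_star using that by (auto simp: A_star_def)
    then show ?thesis
      by (simp add: sum.reindex inj_on_def A_star_def sum.If_cases Int_def flip: sum.inter_filter)
  qed
  have neighbours: "(\<Sum>k\<in>{1..2*n}. if near (Suc i) k then phi_star n k else 0)
      = qsin n 3 * phi_star n (Suc i)" if "i < 2*n" for i
  proof -
    have "(\<Sum>k\<in>{1..2*n}. if near (Suc i) k then phi_star n k else 0)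
        = phi_star n i + phi_star n (Suc i) + phi_star n (Suc (Suc i))"
      by (subst sum_near[OF that]) auto
    also have "\<dots> = qsin n 3 * phi_star n (Suc i)"
      using phi_star_recurrence[OF n, of i] unfolding three by algebra
    finally show ?thesis .
  qed
  have index: "\<exists>j<2*n. i = Suc j" if "i \<in> {1..2*n}" for i
    using that by (intro exI[of _ "i-1"]) auto
  have "adjacency_eigenvector (A_star n) (qsin n 3) (phi_star n)"
    unfolding adjacency_eigenvector_def verts_A_star
  proof (intro conjI ballI)
    show "\<exists>i\<in>{1..2*n}. phi_star n i \<noteq> 0"
      using phi_star_pos[of 1 n] n by (intro bexI[of _ 1]) auto
  next
    fix i assume "i \<in> {1..2*n}"
    then obtain j where j: "j < 2*n" "i = Suc j" using index by blast
    show "(\<Sum>e\<in>out_arcs (A_star n) i. phi_star n (head (A_star n) e)) = qsin n 3 * phi_star n i"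
      unfolding j(2) sum_out[OF j(1)] by (rule neighbours[OF j(1)])
  qed
  moreover have "norm \<mu> \<le> qsin n 3"
    if ev: "adjacency_eigenvector (A_star n) \<mu> x" for \<mu> :: complex and x
  proof -
    define r where "r k = norm (x k) / phi_star n k" for k
    \<comment> \<open>The eigenvalue equation is read off at a vertex where \<open>x\<close> is largest relative to \<open>phi_star\<close>.\<close>
    obtain i where i: "i \<in> {1..2*n}" and max: "\<And>k. k \<in> {1..2*n} \<Longrightarrow> r k \<le> r i"
    proof -
      have "finite (r ` {1..2*n})" "r ` {1..2*n} \<noteq> {}" using n by auto
      from Max_in[OF this] obtain i where "i \<in> {1..2*n}" "Max (r ` {1..2*n}) = r i" by auto
      then show thesis using that[of i] by (metis Max_ge \<open>finite (r ` {1..2*n})\<close> imageI)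
    qed
    obtain j where j: "j < 2*n" "i = Suc j" using index[OF i] by blast
    have bound: "norm (x k) \<le> r i * phi_star n k" if "k \<in> {1..2*n}" for k
      using max[OF that] phi_star_pos[OF that] by (simp add: r_def field_simps)
    obtain k where "k \<in> {1..2*n}" "x k \<noteq> 0"
      using ev unfolding adjacency_eigenvector_def by auto
    then have "0 < r k" using phi_star_pos[of k n] by (simp add: r_def)
    then have "0 < r i" using max[of k] \<open>k \<in> {1..2*n}\<close> by linarith
    then have xi: "0 < norm (x i)"
      using phi_star_pos[OF i] by (auto simp: r_def zero_less_divide_iff)
    have "\<mu> * x i = (\<Sum>k\<in>{1..2*n}. if near i k then x k else 0)"
      using ev i sum_out[OF j(1), of x] unfolding adjacency_eigenvector_def verts_A_star j(2)
      by metis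
    then have "norm \<mu> * norm (x i) = norm (\<Sum>k\<in>{1..2*n}. if near i k then x k else 0)"
      by (metis norm_mult)
    also have "\<dots> \<le> (\<Sum>k\<in>{1..2*n}. if near i k then r i * phi_star n k else 0)"
      by (rule sum_norm_le) (use bound in auto)
    also have "\<dots> = r i * (\<Sum>k\<in>{1..2*n}. if near i k then phi_star n k else 0)"
      unfolding sum_distrib_left by (rule sum.cong) auto
    also have "\<dots> = r i * (qsin n 3 * phi_star n i)"
      using neighbours[OF j(1)] j(2) by simp
    also have "\<dots> = qsin n 3 * norm (x i)"
      using phi_star_pos[OF i] by (simp add: r_def)
    finally show ?thesis using xi by simp
  qed
  ultimately show ?thesis
    unfolding perron_frobenius_def qn3 using phi_star_pos by auto
qed

section \<open>The two solutions\<close>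

lemma near_triple_cases:
  assumes "near a b" "near b c" "near c a"
  obtains i where "(a, b, c) \<in> {(i, i, i), (i, i, Suc i), (i, Suc i, i), (Suc i, i, i),
    (i, Suc i, Suc i), (Suc i, Suc i, i), (Suc i, i, Suc i)}"
proof -
  define i where "i = min a (min b c)"
  have "a = i \<or> a = Suc i" "b = i \<or> b = Suc i" "c = i \<or> c = Suc i"
    using assms unfolding near_def i_def by linarith+
  moreover have "a = i \<or> b = i \<or> c = i" unfolding i_def by linarith
  ultimately show thesis using that[of i] by auto
qed

lemma vertex_cell_eq_0:
  "\<not> near a b \<or> \<not> near b c \<or> \<not> near c a \<Longrightarrow> vertex_cell n s a b c = 0"
proof -
  assume far: "\<not> near a b \<or> \<not> near b c \<or> \<not> near c a"
  define i where "i = min a (min b c)"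
  have "(a, b, c) \<noteq> (i, i, i)" "(a, b, c) \<notin> {(i, i, i+1), (i, i+1, i), (i+1, i, i)}"
    "(a, b, c) \<notin> {(i, i+1, i+1), (i+1, i+1, i), (i+1, i, i+1)}"
    using far by auto
  then show ?thesis unfolding vertex_cell_def Let_def i_def[symmetric] by (simp only: if_False)
qed

lemma vertex_cell_simps:
  "vertex_cell n s i i i = cell_iii n s i"
  "vertex_cell n s i i (Suc i) = cell_iij n s i"
  "vertex_cell n s i (Suc i) i = cell_iij n s i"
  "vertex_cell n s (Suc i) i i = cell_iij n s i"
  "vertex_cell n s i (Suc i) (Suc i) = cell_ijj n s i"
  "vertex_cell n s (Suc i) i (Suc i) = cell_ijj n s i"
  "vertex_cell n s (Suc i) (Suc i) i = cell_ijj n s i"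
  by (simp_all add: vertex_cell_def)

lemma vertex_cell_far:
  "vertex_cell n s i (Suc (Suc i)) k = 0" "vertex_cell n s (Suc (Suc i)) i k = 0"
  "vertex_cell n s i k (Suc (Suc i)) = 0" "vertex_cell n s (Suc (Suc i)) k i = 0"
  "vertex_cell n s k i (Suc (Suc i)) = 0" "vertex_cell n s k (Suc (Suc i)) i = 0"
  by (auto intro: vertex_cell_eq_0 simp: near_def)

lemma vertex_cell_rotate: "vertex_cell n s a b c = vertex_cell n s b c a"
proof (cases "near a b \<and> near b c \<and> near c a")
  case True
  then obtain i where "(a, b, c) \<in> {(i, i, i), (i, i, Suc i), (i, Suc i, i), (Suc i, i, i),
    (i, Suc i, Suc i), (Suc i, Suc i, i), (Suc i, i, Suc i)}"
    using near_triple_cases by metis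
  then show ?thesis by (auto simp: vertex_cell_simps)
next
  case False
  then show ?thesis by (metis vertex_cell_eq_0)
qed

text \<open>
  Besides the rotations the cells admit reflections, because the triangles \<open>i,i,i+1\<close> and \<open>i,i+1,i+1\<close>
  have a repeated vertex.
\<close>

lemma vertex_cell_swap: "vertex_cell n s a b c = vertex_cell n s b a c"
proof (cases "near a b \<and> near b c \<and> near c a")
  case True
  then obtain i where "(a, b, c) \<in> {(i, i, i), (i, i, Suc i), (i, Suc i, i), (Suc i, i, i),
    (i, Suc i, Suc i), (Suc i, Suc i, i), (Suc i, i, Suc i)}"
    using near_triple_cases by metis
  then show ?thesis by (auto simp: vertex_cell_simps)
next
  case False
  then show ?thesis by (metis vertex_cell_eq_0 near_sym)
qed

lemma vertex_form_W_star:
  assumes "i \<in> {1..2*n}" "j \<in> {1..2*n}" "k \<in> {1..2*n}"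
  shows "vertex_form n (W_star n s) i j k = complex_of_real (vertex_cell n s i j k)"
  using assms vertex_cell_eq_0[of i j k n s] unfolding vertex_form_def W_star_def by auto

text \<open>
  At \<open>a = 0\<close> both sides vanish by the convention \<open>inverse 0 = 0\<close>; this covers the two ends of the graph.
\<close>

lemma square_quotient_cancel: "inverse a * (a * b)\<^sup>2 = a * b\<^sup>2" for a b :: real
  by (cases "a = 0") (simp_all add: power2_eq_square)

context
  fixes n :: nat and s :: real
  assumes n: "0 < n" and s: "s = 1 \<or> s = -1"
begin

text \<open>
  Every identity below between the squares of the cells around a vertex or an edge is a polynomial
  consequence of these four relations and their analogues at the next vertex.
\<close>

lemma weight_relations:
  assumes "i < 2*n"
  shows "weight n s (Suc i) * (qsin n 2 - weight n s i) = 1"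
    and "weight n s (Suc i) * (phi_star n (Suc i) + phi_star n (Suc (Suc i)))
       = qsin n 2 * phi_star n (Suc i) - s"
    and "(qsin n 2 - weight n s i) * (phi_star n i + phi_star n (Suc i))
       = qsin n 2 * phi_star n (Suc i) + s"
    and "phi_star n i + 2 * phi_star n (Suc i) + phi_star n (Suc (Suc i))
       = (qsin n 2)\<^sup>2 * phi_star n (Suc i)"
  using assms weight_step[OF n s assms] weight_times[OF n, of "Suc i" s]
    coweight_times[OF n, of i s] phi_star_recurrence[OF n, of i]
  by auto

lemma loop_cells_balance:
  assumes "i < 2*n"
  shows "(cell_ijj n s i)\<^sup>2 + (cell_iii n s (Suc i))\<^sup>2 + (cell_iij n s (Suc i))\<^sup>2
       = qsin n 2 * (phi_star n (Suc i))\<^sup>2"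
proof -
  have 1: "(cell_iij n s (Suc i))\<^sup>2
      = phi_star n (Suc i) * phi_star n (Suc (Suc i)) * weight n s (Suc i)"
    using assms by (intro cell_iij_square[OF n s]) auto
  show ?thesis
    unfolding cell_ijj_square[OF n s assms] cell_iii_square[OF n s assms] 1
    using weight_relations[OF assms] by algebra
qed

lemma edge_cells_balance:
  assumes "Suc i < 2*n"
  shows "(cell_iij n s (Suc i))\<^sup>2 + (cell_ijj n s (Suc i))\<^sup>2
       = qsin n 2 * phi_star n (Suc i) * phi_star n (Suc (Suc i))"
proof -
  have 1: "(cell_iij n s (Suc i))\<^sup>2
      = phi_star n (Suc i) * phi_star n (Suc (Suc i)) * weight n s (Suc i)"
    using assms by (intro cell_iij_square[OF n s]) auto
  show ?thesis
    unfolding cell_ijj_square[OF n s assms] 1 by algebra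
qed

lemma W_star_condition_I:
  assumes "i \<in> {1..2*n}" "j \<in> {1..2*n}" "near i j"
  shows "(\<Sum>k\<in>{1..2*n}. (vertex_cell n s i j k)\<^sup>2) = qsin n 2 * phi_star n i * phi_star n j"
proof -
  have three: "(\<Sum>k\<in>{1..2*n}. (vertex_cell n s (Suc m) l k)\<^sup>2)
      = (vertex_cell n s (Suc m) l m)\<^sup>2 + (vertex_cell n s (Suc m) l (Suc m))\<^sup>2
        + (vertex_cell n s (Suc m) l (Suc (Suc m)))\<^sup>2"
    if "m < 2*n" "l \<in> {1..2*n}" for m l
  proof (rule sum_near[OF that(1)])
    fix k assume "\<not> near (Suc m) k"
    then show "(vertex_cell n s (Suc m) l k)\<^sup>2 = 0"
      using vertex_cell_eq_0[of "Suc m" l k n s] near_sym[of k "Suc m"] by auto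
  next
    \<comment> \<open>At the two ends the formulas for the edge cells give zero, because \<open>[0] = [4n+2] = 0\<close>.\<close>
    have "cell_ijj n s 0 = 0" "cell_iij n s (2*n) = 0"
      using qsin_top[of n] unfolding cell_ijj_def cell_iij_def qnum_qsin
      by (simp_all add: mult.assoc flip: mult_2)
    then have "vertex_cell n s (Suc 0) (Suc 0) 0 = 0"
      and "vertex_cell n s (2*n) (2*n) (Suc (2*n)) = 0"
      by (simp_all add: vertex_cell_simps)
    moreover have "vertex_cell n s a l 0 = 0" if "\<not> (a = Suc 0 \<and> l = Suc 0)" "0 < a" for a
      using that \<open>l \<in> {1..2*n}\<close> by (intro vertex_cell_eq_0) (auto simp: near_def)
    moreover have "vertex_cell n s a l (Suc (2*n)) = 0" if "\<not> (a = 2*n \<and> l = 2*n)" "a \<le> 2*n" for a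
      using that \<open>l \<in> {1..2*n}\<close> by (intro vertex_cell_eq_0) (auto simp: near_def)
    ultimately show "(vertex_cell n s (Suc m) l 0)\<^sup>2 = 0" "(vertex_cell n s (Suc m) l (Suc (2*n)))\<^sup>2 = 0"
      using that(1) by (metis zero_less_Suc power_zero_numeral, metis Suc_leI power_zero_numeral)
  qed
  have edge: "(\<Sum>k\<in>{1..2*n}. (vertex_cell n s (Suc m) (Suc (Suc m)) k)\<^sup>2)
      = qsin n 2 * phi_star n (Suc m) * phi_star n (Suc (Suc m))" if "Suc m < 2*n" for m
    using that edge_cells_balance[OF that]
    by (subst three) (auto simp: vertex_cell_simps vertex_cell_far)
  from \<open>near i j\<close> show ?thesis
  proof (cases rule: near_cases)
    case 1
    obtain m where m: "i = Suc m" "m < 2*n" using assms(1) by (cases i) auto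
    show ?thesis
      unfolding 1 m(1) using three[OF m(2), of "Suc m"] loop_cells_balance[OF m(2)] m
      by (simp add: vertex_cell_simps power2_eq_square)
  next
    case 2
    then show ?thesis using assms edge[of "i-1"] by simp
  next
    case 3
    then show ?thesis
      using assms edge[of "j-1"] vertex_cell_swap[of n s i j] by (simp add: mult_ac)
  qed
qed

text \<open>
  The left-hand side of condition (II) for the real cells, on the closed walk \<open>x, y, z, t\<close>. Its dihedral
  symmetries leave only six shapes to be checked: \<open>i,i,i,i\<close>; \<open>i,i+1,i,i+1\<close>; \<open>i,i,i,i+1\<close>; \<open>i+1,i+1,i+1,i\<close>;
  \<open>i,i+1,i,i-1\<close>; \<open>i,i,i+1,i+1\<close>.
\<close>

definition quartic :: "nat \<Rightarrow> nat \<Rightarrow> nat \<Rightarrow> nat \<Rightarrow> real" where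
  "quartic x y z t = (\<Sum>k\<in>{1..2*n}. inverse (phi_star n k) *
     vertex_cell n s x y k * vertex_cell n s z y k * vertex_cell n s z t k * vertex_cell n s x t k)"

lemma quartic_swap_odd: "quartic x y z t = quartic z y x t"
  unfolding quartic_def by (rule sum.cong) (simp_all add: mult_ac)

lemma quartic_swap_even: "quartic x y z t = quartic x t z y"
  unfolding quartic_def by (rule sum.cong) (simp_all add: mult_ac)

lemma quartic_transpose: "quartic x y z t = quartic y x t z"
  unfolding quartic_def
  by (rule sum.cong) (simp_all add: mult_ac vertex_cell_swap[of n s x] vertex_cell_swap[of n s z])

lemma quartic_three_terms:
  assumes "i < 2*n"
  shows "quartic (Suc i) y z t = (\<Sum>k\<leftarrow>[i, Suc i, Suc (Suc i)]. inverse (phi_star n k) *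
     vertex_cell n s (Suc i) y k * vertex_cell n s z y k * vertex_cell n s z t k
     * vertex_cell n s (Suc i) t k)"
  unfolding quartic_def
proof (subst sum_near[OF assms])
  fix k assume "\<not> near (Suc i) k"
  then show "inverse (phi_star n k) *
     vertex_cell n s (Suc i) y k * vertex_cell n s z y k * vertex_cell n s z t k
     * vertex_cell n s (Suc i) t k = 0"
    using vertex_cell_eq_0[of "Suc i" y k n s] near_sym by auto
qed auto

lemma quartic_loop:
  assumes "i < 2*n"
  shows "quartic (Suc i) (Suc i) (Suc i) (Suc i) = 2 * phi_star n (Suc i) ^ 3"
proof -
  define f0 f1 f2 where f: "f0 = phi_star n i" "f1 = phi_star n (Suc i)" "f2 = phi_star n (Suc (Suc i))"
  define u v d where uvd: "u = weight n s (Suc i)" "v = qsin n 2 - weight n s i" "d = qsin n 2"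
  have A: "(cell_iii n s (Suc i))\<^sup>2 = f1 * (f1 * (u + v - d))"
    unfolding cell_iii_square[OF n s assms] f uvd by (simp add: power2_eq_square)
  have B: "(cell_iij n s (Suc i))\<^sup>2 = f2 * (f1 * u)"
    unfolding f uvd using assms by (subst cell_iij_square[OF n s]) auto
  have C: "(cell_ijj n s i)\<^sup>2 = f0 * (f1 * v)"
    unfolding cell_ijj_square[OF n s assms] f uvd by simp
  have "quartic (Suc i) (Suc i) (Suc i) (Suc i)
      = inverse f0 * ((cell_ijj n s i)\<^sup>2)\<^sup>2 + inverse f1 * ((cell_iii n s (Suc i))\<^sup>2)\<^sup>2
        + inverse f2 * ((cell_iij n s (Suc i))\<^sup>2)\<^sup>2"
    unfolding quartic_three_terms[OF assms] f
    by (simp add: vertex_cell_simps power2_eq_square mult_ac)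
  also have "\<dots> = f0 * (f1 * v)\<^sup>2 + f1 * (f1 * (u + v - d))\<^sup>2 + f2 * (f1 * u)\<^sup>2"
    unfolding A B C square_quotient_cancel ..
  also have "\<dots> = 2 * f1 ^ 3"
    using weight_relations[OF assms, folded f uvd] by algebra
  finally show ?thesis unfolding f .
qed

context
  fixes i f1 f2 A A' B C u v d
  assumes i: "Suc i < 2*n"
  defines "f1 \<equiv> phi_star n (Suc i)" and "f2 \<equiv> phi_star n (Suc (Suc i))"
    and "A \<equiv> cell_iii n s (Suc i)" and "A' \<equiv> cell_iii n s (Suc (Suc i))"
    and "B \<equiv> cell_iij n s (Suc i)" and "C \<equiv> cell_ijj n s (Suc i)"
    and "u \<equiv> weight n s (Suc i)" and "v \<equiv> weight n s (Suc (Suc i))" and "d \<equiv> qsin n 2"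
begin

lemmas edge_phi_defs = f1_def f2_def
lemmas edge_cell_defs = A_def A'_def B_def C_def
lemmas edge_weight_defs = u_def v_def d_def

lemma edge_phi_pos: "0 < f1" "0 < f2"
  unfolding edge_phi_defs using i by (auto intro!: phi_star_pos)

lemma edge_cell_squares:
  "A\<^sup>2 = f1\<^sup>2 * (u - weight n s i)" "A'\<^sup>2 = f2\<^sup>2 * (v - u)" "B\<^sup>2 = f1 * f2 * u" "C\<^sup>2 = f1 * f2 * (d - u)"
  unfolding edge_phi_defs edge_cell_defs edge_weight_defs using i
    cell_iii_square[OF n s, of i] cell_iii_square[OF n s, of "Suc i"]
    cell_iij_square[OF n s, of "Suc i"] cell_ijj_square[OF n s, of "Suc i"]
  by auto

lemma edge_weight_relations: "u * (d - weight n s i) = 1" "v * (d - u) = 1"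
  unfolding edge_weight_defs using i by (auto intro!: weight_step[OF n s])

lemma quartic_edge: "quartic (Suc i) (Suc (Suc i)) (Suc i) (Suc (Suc i)) = f1 * f2 * (f1 + f2)"
proof -
  have "quartic (Suc i) (Suc (Suc i)) (Suc i) (Suc (Suc i))
      = inverse f1 * (B\<^sup>2)\<^sup>2 + inverse f2 * (C\<^sup>2)\<^sup>2"
    using i unfolding edge_phi_defs edge_cell_defs
    by (subst quartic_three_terms) (auto simp: vertex_cell_simps vertex_cell_far power2_eq_square mult_ac)
  also have "\<dots> = f1 * f2 * (f2 * u\<^sup>2 + f1 * (d - u)\<^sup>2)"
    unfolding edge_cell_squares using edge_phi_pos by (simp add: field_simps power2_eq_square)
  also have "f2 * u\<^sup>2 + f1 * (d - u)\<^sup>2 = f1 + f2"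
    using weight_relations[OF Suc_lessD[OF i], folded edge_phi_defs edge_weight_defs] by algebra
  finally show ?thesis .
qed

lemma quartic_loop_up: "quartic (Suc i) (Suc i) (Suc i) (Suc (Suc i)) = f1 * f1 * f2"
proof -
  have "quartic (Suc i) (Suc i) (Suc i) (Suc (Suc i))
      = inverse f1 * (A\<^sup>2 * B\<^sup>2) + inverse f2 * (B\<^sup>2 * C\<^sup>2)"
    using i unfolding edge_phi_defs edge_cell_defs
    by (subst quartic_three_terms) (auto simp: vertex_cell_simps vertex_cell_far power2_eq_square mult_ac)
  also have "\<dots> = f1 * f1 * f2 * (u * (u - weight n s i) + u * (d - u))"
    unfolding edge_cell_squares using edge_phi_pos by (simp add: field_simps power2_eq_square)
  also have "u * (u - weight n s i) + u * (d - u) = 1"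
    using edge_weight_relations by algebra
  finally show ?thesis by simp
qed

lemma quartic_loop_down:
  "quartic (Suc (Suc i)) (Suc (Suc i)) (Suc (Suc i)) (Suc i) = f2 * f2 * f1"
proof -
  have "quartic (Suc (Suc i)) (Suc (Suc i)) (Suc (Suc i)) (Suc i)
      = inverse f1 * (B\<^sup>2 * C\<^sup>2) + inverse f2 * (A'\<^sup>2 * C\<^sup>2)"
    using i unfolding edge_phi_defs edge_cell_defs
    by (subst quartic_three_terms) (auto simp: vertex_cell_simps vertex_cell_far power2_eq_square mult_ac)
  also have "\<dots> = f2 * f2 * f1 * (u * (d - u) + (v - u) * (d - u))"
    unfolding edge_cell_squares using edge_phi_pos by (simp add: field_simps power2_eq_square)
  also have "u * (d - u) + (v - u) * (d - u) = 1"
    using edge_weight_relations by algebra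
  finally show ?thesis by simp
qed

lemma quartic_path:
  "quartic (Suc i) (Suc (Suc i)) (Suc i) i = phi_star n i * f1 * f2"
proof -
  have "quartic (Suc i) (Suc (Suc i)) (Suc i) i = inverse f1 * (B\<^sup>2 * (cell_ijj n s i)\<^sup>2)"
    using i unfolding edge_phi_defs edge_cell_defs
    by (subst quartic_three_terms) (auto simp: vertex_cell_simps vertex_cell_far power2_eq_square mult_ac)
  also have "(cell_ijj n s i)\<^sup>2 = phi_star n i * f1 * (d - weight n s i)"
    unfolding edge_phi_defs edge_weight_defs using i by (intro cell_ijj_square[OF n s]) auto
  also have "inverse f1 * (B\<^sup>2 * (phi_star n i * f1 * (d - weight n s i)))
      = phi_star n i * f1 * f2 * (u * (d - weight n s i))"
    unfolding edge_cell_squares using edge_phi_pos by (simp add: field_simps)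
  finally show ?thesis unfolding edge_weight_relations by simp
qed

text \<open>
  The only condition that sees the signs of the loop cells: the two summands have the same square, by
  \<open>u (u - weight i) = 1 - u (d - u) = (v - u) (d - u)\<close>, and opposite signs because the signs of the loop
  cells alternate along the graph.
\<close>

lemma edge_cells_cancel: "inverse f1 * A * B + inverse f2 * A' * C = 0"
proof -
  define p q where "p = sqrt (u - weight n s i) * B" and "q = sqrt (v - u) * C"
  have pos: "0 \<le> u - weight n s i" "0 \<le> v - u"
    unfolding edge_weight_defs using i weight_strict_mono[OF n s, of i] weight_strict_mono[OF n s, of "Suc i"]
    by auto
  have "p\<^sup>2 = q\<^sup>2"
    unfolding p_def q_def power_mult_distrib real_sqrt_pow2[OF pos(1)] real_sqrt_pow2[OF pos(2)]
      edge_cell_squares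
    using edge_weight_relations by algebra
  moreover have "0 \<le> p" "0 \<le> q"
    unfolding p_def q_def edge_cell_defs using i pos cell_nonneg[OF n s, of "Suc i"] by auto
  ultimately have "p = q" by simp
  moreover have "inverse f1 * A * B = (-1) ^ i * p"
    using edge_phi_pos(1) i unfolding A_def B_def p_def edge_weight_defs edge_phi_defs
    by (subst cell_iii_eq[OF n s]) (auto simp: field_simps)
  moreover have "inverse f2 * A' * C = (-1) ^ Suc i * q"
    using edge_phi_pos(2) i unfolding A'_def C_def q_def edge_weight_defs edge_phi_defs
    by (subst cell_iii_eq[OF n s]) (auto simp: field_simps)
  ultimately show ?thesis by simp
qed

lemma quartic_mixed: "quartic (Suc i) (Suc i) (Suc (Suc i)) (Suc (Suc i)) = 0"
proof -
  have "quartic (Suc i) (Suc i) (Suc (Suc i)) (Suc (Suc i))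
      = B * C * (inverse f1 * A * B + inverse f2 * A' * C)"
    using i unfolding edge_phi_defs edge_cell_defs
    by (subst quartic_three_terms) (auto simp: vertex_cell_simps vertex_cell_far algebra_simps)
  then show ?thesis by (simp add: edge_cells_cancel)
qed

end

lemma quartic_diagonal:
  assumes V: "x \<in> {1..2*n}" "y \<in> {1..2*n}" "t \<in> {1..2*n}" and near: "near x y" "near x t"
  shows "quartic x y x t = (if y = t then phi_star n x * phi_star n y * phi_star n x else 0)
    + phi_star n x * phi_star n y * phi_star n t"
proof -
  obtain i where i: "x = Suc i" "i < 2*n" using V(1) by (cases x) auto
  have up: "Suc i < 2*n" if "Suc (Suc i) \<in> {1..2*n}" using that by auto
  have down: "\<exists>j. i = Suc j \<and> Suc j < 2*n" if "i \<in> {1..2*n}"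
    using that i by (cases i) auto
  show ?thesis
  proof (use near(1) in \<open>cases rule: near_cases\<close>)
    case y: 1
    show ?thesis
    proof (use near(2) in \<open>cases rule: near_cases\<close>)
      case 1
      then show ?thesis using quartic_loop[OF i(2)] i y by (simp add: power3_eq_cube)
    next
      case 2
      then show ?thesis using quartic_loop_up[OF up] V i y by simp
    next
      case 3
      then show ?thesis using quartic_loop_down down V i y by auto
    qed
  next
    case y: 2
    show ?thesis
    proof (use near(2) in \<open>cases rule: near_cases\<close>)
      case 1
      then show ?thesis using quartic_loop_up[OF up] V i y by (subst quartic_swap_even) simp
    next
      case 2
      then show ?thesis using quartic_edge[OF up] V i y by (simp add: algebra_simps)
    next
      case 3
      then show ?thesis using quartic_path[OF up] V i y by simp
    qed
  next
    case y: 3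
    show ?thesis
    proof (use near(2) in \<open>cases rule: near_cases\<close>)
      case 1
      then show ?thesis
        using quartic_loop_down down V i y by (subst quartic_swap_even) auto
    next
      case 2
      then show ?thesis using quartic_path[OF up] V i y by (subst quartic_swap_even) simp
    next
      case 3
      then obtain j where j: "i = Suc j" "Suc j < 2*n" using down V i y by auto
      have "t = Suc j" "y = Suc j" "x = Suc (Suc j)" using 3 y i j by auto
      then show ?thesis
        using quartic_edge[OF j(2)] by (subst quartic_transpose) (simp add: algebra_simps)
    qed
  qed
qed

text \<open>
  If \<open>x\<close> and \<open>z\<close> differ and so do \<open>y\<close> and \<open>t\<close>, then nearness forces \<open>{x,z} = {y,t} = {i,i+1}\<close>, and the
  mixed sum vanishes. Otherwise a transposition reduces to \<open>x = z\<close>.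
\<close>

lemma W_star_condition_II:
  assumes V: "x \<in> {1..2*n}" "y \<in> {1..2*n}" "z \<in> {1..2*n}" "t \<in> {1..2*n}"
    and near: "near x y" "near z y" "near z t" "near x t"
  shows "quartic x y z t = (if y = t then phi_star n x * phi_star n y * phi_star n z else 0)
    + (if x = z then phi_star n x * phi_star n y * phi_star n t else 0)"
proof -
  have zero: "quartic a b c e = 0"
    if "a \<in> {1..2*n}" "c \<in> {1..2*n}" "near a b" "near c b" "near c e" "near a e" "a < c" "b < e"
    for a b c e
  proof -
    have "b = a" "c = Suc a" "e = Suc a" using that unfolding near_def by linarith+
    then show ?thesis using quartic_mixed[of "a-1"] that by simp
  qed
  consider "x = z" | "y = t" "x \<noteq> z" | "x < z" "y < t" | "x < z" "t < y" | "z < x" "y < t" | "z < x" "t < y"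
    by linarith
  then show ?thesis
  proof cases
    case 1
    then show ?thesis using quartic_diagonal V near by simp
  next
    case 2
    have "quartic x y z t = quartic y x y z" unfolding 2(1) by (rule quartic_transpose)
    then show ?thesis
      using quartic_diagonal[of y x z] V near near_sym 2 by (simp add: mult_ac)
  next
    case 3
    then show ?thesis using zero V near by simp
  next
    case 4
    then show ?thesis using zero[of x z t y] V near quartic_swap_even[of x y z t] by simp
  next
    case 5
    then show ?thesis using zero[of z x y t] V near quartic_swap_odd[of x y z t] by simp
  next
    case 6
    then show ?thesis
      using zero[of z x t y] V near quartic_swap_odd[of x y z t] quartic_swap_even[of z y x t] by simp
  qed
qed

lemma cell_system_W_star: "cell_system (A_star n) (q_star n) (phi_star n) (W_star n s)"
  unfolding cell_system_def
proof (intro conjI)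
  show "rotation_invariant (A_star n) (W_star n s)"
    unfolding rotation_invariant_def W_star_def by (metis vertex_cell_rotate)
  have d: "qint (q_star n) 2 = qsin n 2" using qnum_qsin[of n 2] by simp
  show "cell_condition_I (A_star n) (q_star n) (phi_star n) (W_star n s)"
    unfolding cell_condition_I_A_star d
  proof (intro ballI impI)
    fix i j assume ij: "i \<in> {1..2*n}" "j \<in> {1..2*n}" "near i j"
    have "(\<Sum>k\<in>{1..2*n}. vertex_form n (W_star n s) i j k * cnj (vertex_form n (W_star n s) i j k))
        = complex_of_real (\<Sum>k\<in>{1..2*n}. (vertex_cell n s i j k)\<^sup>2)"
      unfolding of_real_sum
      by (rule sum.cong) (use ij in \<open>simp_all add: vertex_form_W_star power2_eq_square\<close>)
    then show "(\<Sum>k\<in>{1..2*n}. vertex_form n (W_star n s) i j k * cnj (vertex_form n (W_star n s) i j k))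
        = complex_of_real (qsin n 2 * phi_star n i * phi_star n j)"
      unfolding W_star_condition_I[OF ij] .
  qed
  show "cell_condition_II (A_star n) (phi_star n) (W_star n s)"
    unfolding cell_condition_II_A_star
  proof (intro ballI impI)
    fix x y z t assume V: "x \<in> {1..2*n}" "y \<in> {1..2*n}" "z \<in> {1..2*n}" "t \<in> {1..2*n}"
      and near: "near x y" "near z y" "near z t" "near x t"
    have "(\<Sum>k\<in>{1..2*n}. complex_of_real (inverse (phi_star n k)) *
           vertex_form n (W_star n s) x y k * cnj (vertex_form n (W_star n s) z y k) *
           vertex_form n (W_star n s) z t k * cnj (vertex_form n (W_star n s) x t k))
        = complex_of_real (quartic x y z t)"
      unfolding quartic_def of_real_sum
      by (rule sum.cong) (use V in \<open>simp_all add: vertex_form_W_star\<close>)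
    then show "(\<Sum>k\<in>{1..2*n}. complex_of_real (inverse (phi_star n k)) *
           vertex_form n (W_star n s) x y k * cnj (vertex_form n (W_star n s) z y k) *
           vertex_form n (W_star n s) z t k * cnj (vertex_form n (W_star n s) x t k))
        = (if y = t then complex_of_real (phi_star n x * phi_star n y * phi_star n z) else 0)
          + (if x = z then complex_of_real (phi_star n x * phi_star n y * phi_star n t) else 0)"
      unfolding W_star_condition_II[OF V near] by simp
  qed
qed (use fin_digraph_A_star perron_frobenius_A_star[OF n] in auto)

end

section \<open>Every cell system is one of the two\<close>

context
  fixes n :: nat and W :: "nat \<times> nat \<Rightarrow> nat \<times> nat \<Rightarrow> nat \<times> nat \<Rightarrow> complex"
  assumes n: "0 < n"
    and W: "cell_system (A_star n) (q_star n) (phi_star n) W"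
begin

abbreviation "w \<equiv> vertex_form n W"

lemma w_rotate: "w i j k = w j k i"
  using W unfolding cell_system_def by (intro vertex_form_rotate) auto

lemma w_orbits:
  "w i (Suc i) i = w i i (Suc i)" "w (Suc i) i i = w i i (Suc i)"
  "w (Suc i) (Suc i) i = w i (Suc i) (Suc i)" "w (Suc i) i (Suc i) = w i (Suc i) (Suc i)"
  using w_rotate by metis+

lemma w_far:
  "w i (Suc (Suc i)) k = 0" "w (Suc (Suc i)) i k = 0"
  "w i k (Suc (Suc i)) = 0" "w (Suc (Suc i)) k i = 0"
  "w k i (Suc (Suc i)) = 0" "w k (Suc (Suc i)) i = 0"
  by (auto intro: vertex_form_eq_0 simp: near_def)

lemma w_outside: "w i j 0 = 0" "w i j (Suc (2*n)) = 0"
  by (simp_all add: vertex_form_def)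

lemma condition_I:
  assumes "i < 2*n" "j \<in> {1..2*n}" "near (Suc i) j"
  shows "(cmod (w (Suc i) j i))\<^sup>2 + (cmod (w (Suc i) j (Suc i)))\<^sup>2
      + (cmod (w (Suc i) j (Suc (Suc i))))\<^sup>2
    = qsin n 2 * phi_star n (Suc i) * phi_star n j"
proof -
  have "(\<Sum>k\<in>{1..2*n}. w (Suc i) j k * cnj (w (Suc i) j k))
      = complex_of_real (qint (q_star n) 2 * phi_star n (Suc i) * phi_star n j)"
    using W assms unfolding cell_system_def cell_condition_I_A_star by simp
  also have "(\<Sum>k\<in>{1..2*n}. w (Suc i) j k * cnj (w (Suc i) j k))
      = w (Suc i) j i * cnj (w (Suc i) j i) + w (Suc i) j (Suc i) * cnj (w (Suc i) j (Suc i))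
      + w (Suc i) j (Suc (Suc i)) * cnj (w (Suc i) j (Suc (Suc i)))"
    using near_sym by (intro sum_near assms) (auto simp: w_outside intro: vertex_form_eq_0)
  also have "\<dots> = complex_of_real ((cmod (w (Suc i) j i))\<^sup>2 + (cmod (w (Suc i) j (Suc i)))\<^sup>2
      + (cmod (w (Suc i) j (Suc (Suc i))))\<^sup>2)"
    by (simp only: complex_norm_square of_real_add)
  finally show ?thesis
    unfolding of_real_eq_iff using qnum_qsin[of n 2] by simp
qed

lemma condition_II:
  assumes "i < 2*n" "y \<in> {1..2*n}" "z \<in> {1..2*n}" "t \<in> {1..2*n}"
    and "near (Suc i) y" "near z y" "near z t" "near (Suc i) t"
  shows "(\<Sum>k\<leftarrow>[i, Suc i, Suc (Suc i)]. complex_of_real (inverse (phi_star n k)) *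
           w (Suc i) y k * cnj (w z y k) * w z t k * cnj (w (Suc i) t k))
        = (if y = t then complex_of_real (phi_star n (Suc i) * phi_star n y * phi_star n z) else 0)
          + (if Suc i = z then complex_of_real (phi_star n (Suc i) * phi_star n y * phi_star n t) else 0)"
proof -
  have "Suc i \<in> {1..2*n}" using assms(1) by simp
  then have "(\<Sum>k\<in>{1..2*n}. complex_of_real (inverse (phi_star n k)) *
           w (Suc i) y k * cnj (w z y k) * w z t k * cnj (w (Suc i) t k))
        = (if y = t then complex_of_real (phi_star n (Suc i) * phi_star n y * phi_star n z) else 0)
          + (if Suc i = z then complex_of_real (phi_star n (Suc i) * phi_star n y * phi_star n t) else 0)"
    using W assms unfolding cell_system_def cell_condition_II_A_star by blast
  moreover have "w (Suc i) y k = 0" if "\<not> near (Suc i) k" for k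
    using that near_sym by (blast intro: vertex_form_eq_0)
  ultimately show ?thesis
    by (subst (asm) sum_near[OF assms(1)]) (auto simp: w_outside add.assoc)
qed

text \<open>
  Five kinds of instances of (I) and (II) determine a cell system up to equivalence: the loops and the
  edges in (I), and in (II) the edges, the paths of three vertices, and the closed walk \<open>i, i, i+1, i+1\<close>,
  which relates the phases of the loop cells at the two ends of an edge.
\<close>

lemma modulus_loop:
  assumes "i < 2*n"
  shows "(cmod (w i (Suc i) (Suc i)))\<^sup>2 + (cmod (w (Suc i) (Suc i) (Suc i)))\<^sup>2
      + (cmod (w (Suc i) (Suc i) (Suc (Suc i))))\<^sup>2 = qsin n 2 * (phi_star n (Suc i))\<^sup>2"
  using condition_I[OF assms, of "Suc i"] assms by (simp add: w_orbits power2_eq_square)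

lemma modulus_edge:
  assumes "Suc i < 2*n"
  shows "(cmod (w (Suc i) (Suc i) (Suc (Suc i))))\<^sup>2 + (cmod (w (Suc i) (Suc (Suc i)) (Suc (Suc i))))\<^sup>2
      = qsin n 2 * phi_star n (Suc i) * phi_star n (Suc (Suc i))"
  using condition_I[of i "Suc (Suc i)"] assms by (simp add: w_orbits w_far)

lemma modulus_edge_quartic:
  assumes "Suc i < 2*n"
  defines "f1 \<equiv> phi_star n (Suc i)" and "f2 \<equiv> phi_star n (Suc (Suc i))"
  shows "inverse f1 * ((cmod (w (Suc i) (Suc i) (Suc (Suc i))))\<^sup>2)\<^sup>2
      + inverse f2 * ((cmod (w (Suc i) (Suc (Suc i)) (Suc (Suc i))))\<^sup>2)\<^sup>2 = f1 * f2 * (f1 + f2)"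
proof -
  define b c where "b = w (Suc i) (Suc i) (Suc (Suc i))" and "c = w (Suc i) (Suc (Suc i)) (Suc (Suc i))"
  have "complex_of_real (inverse f1 * ((cmod b)\<^sup>2)\<^sup>2 + inverse f2 * ((cmod c)\<^sup>2)\<^sup>2)
      = complex_of_real (inverse f1) * (b * cnj b)\<^sup>2 + complex_of_real (inverse f2) * (c * cnj c)\<^sup>2"
    by (simp only: complex_norm_square[symmetric] of_real_add of_real_mult of_real_power)
  also have "\<dots> = complex_of_real (f1 * f2 * (f1 + f2))"
    using condition_II[of i "Suc (Suc i)" "Suc i" "Suc (Suc i)"] assms
    by (simp add: w_orbits w_far b_def c_def power2_eq_square algebra_simps)
  finally show ?thesis unfolding of_real_eq_iff b_def c_def .
qed

lemma modulus_path:
  assumes "Suc (Suc i) < 2*n"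
  defines "f1 \<equiv> phi_star n (Suc i)" and "f2 \<equiv> phi_star n (Suc (Suc i))"
    and "f3 \<equiv> phi_star n (Suc (Suc (Suc i)))"
  shows "(cmod (w (Suc (Suc i)) (Suc (Suc i)) (Suc (Suc (Suc i)))))\<^sup>2
      * (cmod (w (Suc i) (Suc (Suc i)) (Suc (Suc i))))\<^sup>2 = f1 * f2\<^sup>2 * f3"
proof -
  define b c where "b = w (Suc (Suc i)) (Suc (Suc i)) (Suc (Suc (Suc i)))"
    and "c = w (Suc i) (Suc (Suc i)) (Suc (Suc i))"
  have "f2 \<noteq> 0" unfolding f2_def using phi_star_pos[of "Suc (Suc i)" n] assms by auto
  have "complex_of_real (inverse f2) * ((b * cnj b) * (c * cnj c)) = complex_of_real (f2 * f3 * f1)"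
    using condition_II[of "Suc i" "Suc (Suc (Suc i))" "Suc (Suc i)" "Suc i"] assms
    by (simp add: w_orbits w_far b_def c_def mult_ac)
  then have "complex_of_real (inverse f2 * ((cmod b)\<^sup>2 * (cmod c)\<^sup>2)) = complex_of_real (f2 * f3 * f1)"
    by (simp only: complex_norm_square[symmetric] of_real_mult)
  then have "inverse f2 * ((cmod b)\<^sup>2 * (cmod c)\<^sup>2) = f2 * f3 * f1"
    unfolding of_real_eq_iff .
  then show ?thesis
    using \<open>f2 \<noteq> 0\<close> unfolding b_def c_def by (simp add: field_simps power2_eq_square)
qed

lemma phase_relation:
  assumes "Suc i < 2*n"
  defines "b \<equiv> w (Suc i) (Suc i) (Suc (Suc i))" and "c \<equiv> w (Suc i) (Suc (Suc i)) (Suc (Suc i))"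
  shows "complex_of_real (inverse (phi_star n (Suc i))) * w (Suc i) (Suc i) (Suc i) * (cnj b)\<^sup>2 * c
    + complex_of_real (inverse (phi_star n (Suc (Suc i))))
        * w (Suc (Suc i)) (Suc (Suc i)) (Suc (Suc i)) * (cnj c)\<^sup>2 * b = 0"
  using condition_II[of i "Suc i" "Suc (Suc i)" "Suc (Suc i)"] assms
  by (simp add: w_orbits w_far b_def c_def power2_eq_square mult_ac)

text \<open>
  Put \<open>|W_{1,1,2}|\<^sup>2 = \<phi>_1 \<phi>_2 \<beta>\<close>. Conditions (I) and (II) on the edge \<open>{1, 2}\<close> give
  \<open>\<phi>_2 \<beta>\<^sup>2 + \<phi>_1 ([2] - \<beta>)\<^sup>2 = \<phi>_1 + \<phi>_2\<close>. With \<open>\<phi>_1 = 1\<close> and \<open>\<phi>_2 = [2]\<^sup>2 - 2\<close> this factors as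
  \<open>(([2] + 1) \<beta> - 1) (([2] - 1) \<beta> - 1) = 0\<close>: here the two signs appear.
\<close>

lemma modulus_first_edge:
  obtains s where "s = 1 \<or> s = -1"
    and "(cmod (w 1 1 2))\<^sup>2 = phi_star n 1 * phi_star n 2 * weight n s 1"
proof -
  define d where "d = qsin n 2"
  have d: "0 < d" using qsin_2_pos[OF n] by (simp add: d_def)
  have three: "qsin n 3 = d\<^sup>2 - 1" "0 < qsin n 3"
    using qsin_neighbours[of n 1] qsin_pos[of 3 n] n by (simp_all add: eval_nat_numeral d_def)
  have f1: "phi_star n 1 = 1" using d by (simp add: phi_star_eq d_def)
  have f2: "phi_star n 2 = d\<^sup>2 - 2"
    using phi_star_add_Suc[OF n, of 1] f1 three(1) by (simp add: eval_nat_numeral)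
  have f2_pos: "0 < phi_star n 2" using n by (intro phi_star_pos) auto
  have d1: "1 < d" using even_gt_1[of 1 n] n by (simp add: d_def)
  define \<beta> where "\<beta> = (cmod (w 1 1 2))\<^sup>2 / phi_star n 2"
  have \<beta>: "(cmod (w 1 1 2))\<^sup>2 = phi_star n 2 * \<beta>" using f2_pos by (simp add: \<beta>_def)
  have "Suc 0 < 2*n" using n by simp
  note eqs = modulus_edge[OF this] modulus_edge_quartic[OF this]
  have c: "(cmod (w 1 2 2))\<^sup>2 = phi_star n 2 * (d - \<beta>)"
    using eqs(1) \<beta> f1 unfolding d_def by (simp add: numeral_2_eq_2 algebra_simps)
  have "(phi_star n 2 * \<beta>)\<^sup>2 + inverse (phi_star n 2) * (phi_star n 2 * (d - \<beta>))\<^sup>2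
      = phi_star n 2 * (1 + phi_star n 2)"
    using eqs(2) f1 unfolding \<beta>[symmetric] c[symmetric] by (simp add: numeral_2_eq_2)
  then have "phi_star n 2 * (phi_star n 2 * \<beta>\<^sup>2 + (d - \<beta>)\<^sup>2) = phi_star n 2 * (1 + phi_star n 2)"
    using f2_pos by (simp add: square_quotient_cancel algebra_simps power_mult_distrib power2_eq_square)
  then have "phi_star n 2 * \<beta>\<^sup>2 + (d - \<beta>)\<^sup>2 = 1 + phi_star n 2"
    using f2_pos by simp
  then have "((d + 1) * \<beta> - 1) * ((d - 1) * \<beta> - 1) = 0"
    unfolding f2 by algebra
  then consider "(d + 1) * \<beta> = 1" | "(d - 1) * \<beta> = 1" by auto
  then show thesis
  proof cases
    case 1
    have "weight n 1 1 = (d - 1) / (d\<^sup>2 - 1)"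
      unfolding weight_def using three by (simp add: d_def numeral_2_eq_2 numeral_3_eq_3)
    also have "\<dots> = \<beta>" using 1 d1 three by (simp add: field_simps) algebra
    finally show thesis using that[of 1] \<beta> f1 by simp
  next
    case 2
    have "weight n (-1) 1 = (d + 1) / (d\<^sup>2 - 1)"
      unfolding weight_def using three by (simp add: d_def numeral_2_eq_2 numeral_3_eq_3)
    also have "\<dots> = \<beta>" using 2 d1 three by (simp add: field_simps) algebra
    finally show thesis using that[of "-1"] \<beta> f1 by simp
  qed
qed

text \<open>
  The first edge fixes the sign. From there the path relation determines \<open>|W_{i,i,i+1}|\<close> from
  \<open>|W_{i-1,i,i}|\<close>, the edge relation then gives \<open>|W_{i,i+1,i+1}|\<close>, and the loop relation gives
  \<open>|W_{i,i,i}|\<close>. The model satisfies the same relations, so the moduli agree.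
\<close>

lemma moduli:
  obtains s where "s = 1 \<or> s = -1"
    and "\<And>i. Suc i < 2*n \<Longrightarrow> cmod (w (Suc i) (Suc i) (Suc (Suc i))) = cell_iij n s (Suc i)"
    and "\<And>i. Suc i < 2*n \<Longrightarrow> cmod (w (Suc i) (Suc (Suc i)) (Suc (Suc i))) = cell_ijj n s (Suc i)"
    and "\<And>i. i < 2*n \<Longrightarrow> cmod (w (Suc i) (Suc i) (Suc i)) = \<bar>cell_iii n s (Suc i)\<bar>"
proof -
  obtain s where s: "s = 1 \<or> s = -1"
    and first: "(cmod (w 1 1 2))\<^sup>2 = phi_star n 1 * phi_star n 2 * weight n s 1"
    by (rule modulus_first_edge)
  have b: "(cmod (w (Suc i) (Suc i) (Suc (Suc i))))\<^sup>2 = (cell_iij n s (Suc i))\<^sup>2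
      \<and> (cmod (w (Suc i) (Suc (Suc i)) (Suc (Suc i))))\<^sup>2 = (cell_ijj n s (Suc i))\<^sup>2"
    if "Suc i < 2*n" for i
    using that
  proof (induction i)
    case 0
    have "(cell_iij n s (Suc 0))\<^sup>2 = phi_star n 1 * phi_star n 2 * weight n s 1"
      using 0 by (subst cell_iij_square[OF n s]) (auto simp: numeral_2_eq_2)
    then show ?case
      using first modulus_edge[OF 0] edge_cells_balance[OF n s 0] by (simp add: numeral_2_eq_2)
  next
    case (Suc i)
    define f1 f2 f3 where "f1 = phi_star n (Suc i)" and "f2 = phi_star n (Suc (Suc i))"
      and "f3 = phi_star n (Suc (Suc (Suc i)))"
    define v where "v = qsin n 2 - weight n s (Suc i)"
    have pos: "0 < f1" "0 < f2"
      using Suc.prems by (auto simp: f1_def f2_def intro!: phi_star_pos)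
    have uv: "weight n s (Suc (Suc i)) * v = 1"
      unfolding v_def using Suc.prems by (intro weight_step[OF n s]) auto
    have c: "(cmod (w (Suc i) (Suc (Suc i)) (Suc (Suc i))))\<^sup>2 = f1 * f2 * v"
      unfolding f1_def f2_def v_def using Suc cell_ijj_square[OF n s, of "Suc i"] by simp
    have "(cell_iij n s (Suc (Suc i)))\<^sup>2 * (f1 * f2 * v) = f1 * f2\<^sup>2 * f3"
      unfolding f1_def f2_def f3_def using Suc.prems uv
      by (subst cell_iij_square[OF n s]) (auto simp: power2_eq_square algebra_simps)
    also have "\<dots> = (cmod (w (Suc (Suc i)) (Suc (Suc i)) (Suc (Suc (Suc i)))))\<^sup>2 * (f1 * f2 * v)"
      using modulus_path[OF Suc.prems] unfolding c f1_def f2_def f3_def by (rule sym)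
    finally have "(cmod (w (Suc (Suc i)) (Suc (Suc i)) (Suc (Suc (Suc i)))))\<^sup>2
        = (cell_iij n s (Suc (Suc i)))\<^sup>2"
      using pos uv by auto
    then show ?case
      using modulus_edge[OF Suc.prems] edge_cells_balance[OF n s Suc.prems] by linarith
  qed
  have a: "(cmod (w (Suc i) (Suc i) (Suc i)))\<^sup>2 = \<bar>cell_iii n s (Suc i)\<bar>\<^sup>2" if "i < 2*n" for i
  proof -
    have "(cmod (w i (Suc i) (Suc i)))\<^sup>2 = (cell_ijj n s i)\<^sup>2"
    proof (cases i)
      case 0
      then show ?thesis
        using w_outside(1)[of 1 1] w_orbits(3)[of 0] cell_ijj_square[OF n s, of 0] n by simp
    next
      case (Suc j)
      then show ?thesis using b[of j] that by simp
    qed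
    moreover have "(cmod (w (Suc i) (Suc i) (Suc (Suc i))))\<^sup>2 = (cell_iij n s (Suc i))\<^sup>2"
    proof (cases "Suc i < 2*n")
      case True
      then show ?thesis using b[of i] by simp
    next
      case False
      then have e: "Suc i = 2*n" using that by simp
      show ?thesis
        unfolding e using w_outside(2)[of "2*n" "2*n"] n cell_iij_square[OF n s, of "2*n"] by simp
    qed
    ultimately show ?thesis
      using modulus_loop[OF that] loop_cells_balance[OF n s that] by simp
  qed
  show thesis
  proof (rule that[OF s])
    fix i assume i: "Suc i < 2*n"
    show "cmod (w (Suc i) (Suc i) (Suc (Suc i))) = cell_iij n s (Suc i)"
      "cmod (w (Suc i) (Suc (Suc i)) (Suc (Suc i))) = cell_ijj n s (Suc i)"
      using b[OF i] cell_nonneg[OF n s, of "Suc i"] i by (auto simp: power2_eq_iff_nonneg)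
  next
    fix i assume "i < 2*n"
    then show "cmod (w (Suc i) (Suc i) (Suc i)) = \<bar>cell_iii n s (Suc i)\<bar>"
      using a by (simp only: power2_eq_iff_nonneg norm_ge_zero abs_ge_zero)
  qed
qed

text \<open>
  The phase \<open>x 1\<close> of the first loop is a cube root that matches \<open>W_{1,1,1}\<close>. The phase \<open>v i\<close> of the edge from
  \<open>i\<close> to \<open>i+1\<close> is chosen to match \<open>W_{i,i,i+1}\<close>, and then \<open>x (i+1)\<close> to match \<open>W_{i,i+1,i+1}\<close>; the reverse
  edges keep phase \<open>1\<close>. No freedom is left for the other loop cells, but there the phase relation
  determines \<open>W_{i+1,i+1,i+1}\<close> from the cells already matched, as it does in the model.
\<close>

lemma cell_system_equivalent:
  "\<exists>s. (s = 1 \<or> s = -1) \<and> cell_equivalent (A_star n) W (W_star n s)"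
proof -
  obtain s where s: "s = 1 \<or> s = -1"
    and mod_b: "\<And>i. Suc i < 2*n \<Longrightarrow> cmod (w (Suc i) (Suc i) (Suc (Suc i))) = cell_iij n s (Suc i)"
    and mod_c: "\<And>i. Suc i < 2*n \<Longrightarrow> cmod (w (Suc i) (Suc (Suc i)) (Suc (Suc i))) = cell_ijj n s (Suc i)"
    and mod_a: "\<And>i. i < 2*n \<Longrightarrow> cmod (w (Suc i) (Suc i) (Suc i)) = \<bar>cell_iii n s (Suc i)\<bar>"
    by (rule moduli) blast
  define a b c where "a i = w i i i" and "b i = w i i (Suc i)" and "c i = w i (Suc i) (Suc i)" for i
  define A B C where "A i = complex_of_real (cell_iii n s i)"
    and "B i = complex_of_real (cell_iij n s i)" and "C i = complex_of_real (cell_ijj n s i)" for i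
  have cell_pos: "0 < cell_iij n s (Suc i)" "0 < cell_ijj n s (Suc i)" if "Suc i < 2*n" for i
  proof -
    have "0 < phi_star n (Suc i) * phi_star n (Suc (Suc i))"
      using that by (intro mult_pos_pos phi_star_pos) auto
    moreover have "0 < weight n s (Suc i)" "0 < qsin n 2 - weight n s (Suc i)"
      using that weight_pos[OF n s, of "Suc i"] coweight_pos[OF n s, of "Suc i"] by auto
    ultimately have "(cell_iij n s (Suc i))\<^sup>2 \<noteq> 0" "(cell_ijj n s (Suc i))\<^sup>2 \<noteq> 0"
      using that cell_iij_square[OF n s, of "Suc i"] cell_ijj_square[OF n s, of "Suc i"] by auto
    moreover have "0 \<le> cell_iij n s (Suc i)" "0 \<le> cell_ijj n s (Suc i)"
      using that by (auto intro!: cell_nonneg[OF n s])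
    ultimately show "0 < cell_iij n s (Suc i)" "0 < cell_ijj n s (Suc i)"
      by (auto simp: less_le)
  qed
  have "(cell_iii n s (Suc 0))\<^sup>2 \<noteq> 0"
    using n phi_star_pos[of "Suc 0" n] weight_strict_mono[OF n s, of 0]
    by (subst cell_iii_square[OF n s]) auto
  then have A1: "A 1 \<noteq> 0" by (simp add: A_def)
  \<comment> \<open>the quotient of consecutive loop phases that makes both cells on the edge match\<close>
  define r where "r i = c i / C i * (B i / b i)" for i
  define \<rho> where "\<rho> = cis (Arg (a 1 / A 1) / 3)"
  define x where "x i = \<rho> * (\<Prod>k\<in>{1..<i}. r k)" for i
  define v where "v i = b i / (B i * x i)" for i
  have nonzero: "B (Suc i) \<noteq> 0" "C (Suc i) \<noteq> 0" "b (Suc i) \<noteq> 0" "c (Suc i) \<noteq> 0"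
    if "Suc i < 2*n" for i
    using cell_pos[OF that] mod_b[OF that] mod_c[OF that]
    by (auto simp: B_def C_def b_def c_def)
  have norm_r: "cmod (r (Suc i)) = 1" if "Suc i < 2*n" for i
    using cell_pos[OF that] mod_b[OF that] mod_c[OF that]
    by (simp add: r_def B_def C_def b_def c_def norm_mult norm_divide)
  have norm_x: "cmod (x i) = 1" if "i \<in> {1..2*n}" for i
  proof -
    have "cmod (r k) = 1" if "k \<in> {1..<i}" for k
      using norm_r[of "k-1"] that \<open>i \<in> {1..2*n}\<close> by simp
    then show ?thesis by (simp add: x_def \<rho>_def norm_mult flip: prod_norm)
  qed
  have norm_v: "cmod (v (Suc i)) = 1" if "Suc i < 2*n" for i
    using cell_pos[OF that] mod_b[OF that] norm_x[of "Suc i"] that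
    by (simp add: v_def B_def b_def norm_mult norm_divide)
  have x_Suc: "x (Suc (Suc i)) = x (Suc i) * r (Suc i)" for i
    by (simp add: x_def)
  have x_nz: "x (Suc i) \<noteq> 0" if "i < 2*n" for i
    using norm_x[of "Suc i"] that by auto
  have b_eq: "b (Suc i) = x (Suc i) * v (Suc i) * B (Suc i)"
    and c_eq: "c (Suc i) = v (Suc i) * x (Suc (Suc i)) * C (Suc i)" if "Suc i < 2*n" for i
    using nonzero[OF that] x_nz[of i] that by (auto simp: x_Suc v_def r_def)
  have unit: "cnj z * z = 1" if "cmod z = 1" for z
    using that complex_norm_square[of z] by (simp add: mult.commute)
  have a_eq: "a (Suc i) = x (Suc i) ^ 3 * A (Suc i)" if "i < 2*n" for i
    using that
  proof (induction i)
    case 0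
    have "cmod (a 1 / A 1) = 1"
      using mod_a[of 0] n A1 by (simp add: a_def A_def norm_divide)
    then have "cis (Arg (a 1 / A 1)) = a 1 / A 1"
      using rcis_cmod_Arg[of "a 1 / A 1"] by (simp add: rcis_def)
    moreover have "\<rho> ^ 3 = cis (real 3 * (Arg (a 1 / A 1) / 3))"
      unfolding \<rho>_def by (rule Complex.DeMoivre)
    moreover have "real 3 * (Arg (a 1 / A 1) / 3) = Arg (a 1 / A 1)" by simp
    ultimately have "\<rho> ^ 3 = a 1 / A 1" by metis
    then show ?case using A1 by (simp add: x_def)
  next
    case (Suc i)
    define p where "p j = complex_of_real (inverse (phi_star n j))" for j
    define x1 x2 v1 where "x1 = x (Suc i)" and "x2 = x (Suc (Suc i))" and "v1 = v (Suc i)"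
    define b1 c1 where "b1 = b (Suc i)" and "c1 = c (Suc i)"
    have nz: "x1 \<noteq> 0" "p (Suc (Suc i)) \<noteq> 0" "B (Suc i) \<noteq> 0" "C (Suc i) \<noteq> 0"
      using x_nz[of i] phi_star_pos[of "Suc (Suc i)" n] nonzero[of i] Suc.prems
      by (auto simp: p_def x1_def)
    have units: "cnj x1 * x1 = 1" "cnj x2 * x2 = 1" "cnj v1 * v1 = 1"
      using Suc.prems norm_x norm_v unfolding x1_def x2_def v1_def by (auto intro!: unit)
    have b1: "b1 = x1 * v1 * B (Suc i)" and c1: "c1 = v1 * x2 * C (Suc i)"
      using b_eq c_eq Suc.prems unfolding b1_def c1_def x1_def x2_def v1_def by auto
    have "cnj b1 = cnj x1 * cnj v1 * B (Suc i)" "cnj c1 = cnj v1 * cnj x2 * C (Suc i)"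
      by (simp_all add: b1 c1 B_def C_def)
    then have cb: "cnj b1 * x1 * v1 = B (Suc i)" and cc: "cnj c1 * v1 * x2 = C (Suc i)"
      using units by algebra+
    have model: "p (Suc i) * A (Suc i) * B (Suc i) + p (Suc (Suc i)) * A (Suc (Suc i)) * C (Suc i) = 0"
      using arg_cong[OF edge_cells_cancel[OF n s Suc.prems], of complex_of_real]
      by (simp add: p_def A_def B_def C_def)
    have rel: "p (Suc i) * a (Suc i) * (cnj b1)\<^sup>2 * c1
        + p (Suc (Suc i)) * a (Suc (Suc i)) * (cnj c1)\<^sup>2 * b1 = 0"
      using phase_relation[OF Suc.prems] unfolding p_def a_def b_def c_def b1_def c1_def .
    have IH: "a (Suc i) = x1 ^ 3 * A (Suc i)" using Suc x1_def by simp
    \<comment> \<open>Multiplying the relation by \<open>v1 * x2\<^sup>2\<close> removes all conjugates.\<close>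
    have first: "p (Suc i) * a (Suc i) * (cnj b1)\<^sup>2 * c1 * (v1 * x2\<^sup>2)
        = x1 * p (Suc i) * A (Suc i) * (cnj b1 * x1 * v1)\<^sup>2 * x2 ^ 3 * C (Suc i)"
      using IH c1 by algebra
    have second: "p (Suc (Suc i)) * a (Suc (Suc i)) * (cnj c1)\<^sup>2 * b1 * (v1 * x2\<^sup>2)
        = x1 * p (Suc (Suc i)) * a (Suc (Suc i)) * B (Suc i) * (cnj c1 * v1 * x2)\<^sup>2"
      using b1 by algebra
    have "x1 * p (Suc i) * A (Suc i) * (B (Suc i))\<^sup>2 * x2 ^ 3 * C (Suc i)
        + x1 * p (Suc (Suc i)) * a (Suc (Suc i)) * B (Suc i) * (C (Suc i))\<^sup>2 = 0"
      using arg_cong[OF rel, of "\<lambda>e. e * (v1 * x2\<^sup>2)"]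
      unfolding distrib_right first second cb cc by simp
    then have "x1 * p (Suc (Suc i)) * B (Suc i) * (C (Suc i))\<^sup>2
        * (a (Suc (Suc i)) - x2 ^ 3 * A (Suc (Suc i))) = 0"
      using model by algebra
    then show ?case using nz by (simp add: x2_def)
  qed
  define u where "u i j = (if j = i then x i else if j = Suc i then v i else 1)" for i j
  have "cell_equivalent (A_star n) W (W_star n s)"
    unfolding cell_equivalent_A_star
  proof (intro exI[of _ u] conjI ballI impI)
    fix i j assume V: "i \<in> {1..2*n}" "j \<in> {1..2*n}" and "near i j"
    then show "cmod (u i j) = 1"
      using norm_x[of i] norm_v[of "i-1"] by (auto simp: u_def)
  next
    fix i j k assume V: "i \<in> {1..2*n}" "j \<in> {1..2*n}" "k \<in> {1..2*n}"
    show "w i j k = u i j * u j k * u k i * vertex_form n (W_star n s) i j k"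
    proof (cases "near i j \<and> near j k \<and> near k i")
      case True
      then obtain m where m: "(i, j, k) \<in> {(m, m, m), (m, m, Suc m), (m, Suc m, m), (Suc m, m, m),
          (m, Suc m, Suc m), (Suc m, Suc m, m), (Suc m, m, Suc m)}"
        using near_triple_cases by metis
      have m0: "m = Suc (m-1)" using m V by auto
      have loop: "w m m m = x m ^ 3 * A m" if "m \<le> 2*n"
        using a_eq[of "m-1"] m0 that by (simp add: a_def)
      have edge: "w m m (Suc m) = x m * v m * B m" "w m (Suc m) (Suc m) = v m * x (Suc m) * C m"
        if "Suc m \<le> 2*n"
        using b_eq[of "m-1"] c_eq[of "m-1"] m0 that by (simp_all add: b_def c_def)
      show ?thesis
        unfolding vertex_form_W_star[OF V] using m V loop edge
        by (auto simp: w_orbits vertex_cell_simps u_def A_def B_def C_def power3_eq_cube)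
    next
      case False
      then show ?thesis using vertex_form_eq_0 by auto
    qed
  qed
  then show ?thesis using s by blast
qed

end

text \<open>
  Equivalence preserves the modulus of each cell, and \<open>|W_{1,1,2}|\<close> is different for the two signs.
\<close>

lemma W_star_inequivalent:
  assumes n: "0 < n"
  shows "\<not> cell_equivalent (A_star n) (W_star n 1) (W_star n (-1))"
proof
  assume "cell_equivalent (A_star n) (W_star n 1) (W_star n (-1))"
  then obtain u where unit: "\<And>i j. i \<in> {1..2*n} \<Longrightarrow> j \<in> {1..2*n} \<Longrightarrow> near i j \<Longrightarrow> cmod (u i j) = 1"
    and eq: "\<And>i j k. i \<in> {1..2*n} \<Longrightarrow> j \<in> {1..2*n} \<Longrightarrow> k \<in> {1..2*n} \<Longrightarrow>
      vertex_form n (W_star n 1) i j k = u i j * u j k * u k i * vertex_form n (W_star n (-1)) i j k"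
    unfolding cell_equivalent_A_star by blast
  have V: "1 \<in> {1..2*n}" "Suc 1 \<in> {1..2*n}" using n by auto
  have "cmod (complex_of_real (cell_iij n 1 1)) = cmod (complex_of_real (cell_iij n (-1) 1))"
    using arg_cong[OF eq[OF V(1) V(1) V(2)], of cmod] unit[OF V(1) V(1)] unit[OF V(1) V(2)] unit[OF V(2) V(1)]
    unfolding vertex_form_W_star[OF V(1) V(1) V(2)] vertex_cell_simps by (simp add: norm_mult)
  then have "(cell_iij n 1 1)\<^sup>2 = (cell_iij n (-1) 1)\<^sup>2"
    unfolding norm_of_real by (metis power2_abs)
  then have "phi_star n 1 * phi_star n (Suc 1) * weight n 1 1
      = phi_star n 1 * phi_star n (Suc 1) * weight n (-1) 1"
    using cell_iij_square[OF n, of 1 1] cell_iij_square[OF n, of "-1" 1] V by simp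
  then have "weight n 1 1 = weight n (-1) 1"
    using phi_star_pos[OF V(1)] phi_star_pos[OF V(2)] by simp
  moreover have "0 < qsin n 3" using n by (intro qsin_pos) auto
  ultimately show False by (simp add: weight_def numeral_3_eq_3)
qed

theorem theorem7p4:
  fixes n :: nat
  assumes "1 \<le> n"
  shows "cell_system (A_star n) (q_star n) (phi_star n) (W_plus n)
    \<and> cell_system (A_star n) (q_star n) (phi_star n) (W_minus n)
    \<and> \<not> cell_equivalent (A_star n) (W_plus n) (W_minus n)
    \<and> (\<forall>W. cell_system (A_star n) (q_star n) (phi_star n) W \<longrightarrow>
          cell_equivalent (A_star n) W (W_plus n) \<or> cell_equivalent (A_star n) W (W_minus n))"
proof -
  have n: "0 < n" using assms by simp
  show ?thesis
    using cell_system_W_star[OF n, of 1] cell_system_W_star[OF n, of "-1"]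
      W_star_inequivalent[OF n] cell_system_equivalent[OF n] by blast
qed

end
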